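(* For every positive integer $n$ there exists a perfect subgroup $G$ of the special linear group $\mathrm{SL}_{2n}(\mathbb{F}_4)$ such that the direct power $G^{2^{n-1}}$ contains a subdirect subgroup which has a nilpotent quotient of class $n-1$.
   Context: $\mathbb{F}_4$ is the field with $4$ elements. A group $G$ is perfect if $[G,G]=G$. A subgroup of a direct product is subdirect if its projection to each factor is surjective. "Class $c$" means nilpotency class exactly $c$ (the trivial group has class $0$). *)

theory Defs
  imports
    "HOL-Library.Cardinality"
    "HOL-Algebra.Generated_Groups"
    "HOL-Algebra.Product_Groups"
    "Jordan_Normal_Form.Determinant"
begin

definition special_linear_group :: "'a::comm_ring_1 itself \<Rightarrow> nat \<Rightarrow> 'a mat monoid" where
  "special_linear_group (ty :: 'a itself) n =
     \<lparr>carrier = {A \<in> carrier_mat n n. det A = (1::'a)}, monoid.mult = (*), one = 1\<^sub>m n\<rparr>"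

lemma group_special_linear_group:
  "group (special_linear_group TYPE('a::comm_ring_1) n)"
proof (rule groupI)
  fix A
  assume "A \<in> carrier (special_linear_group TYPE('a) n)"
  then have A: "A \<in> carrier_mat n n" and d: "det A = 1"
    by (auto simp: special_linear_group_def)
  have adj: "adj_mat A \<in> carrier_mat n n" and "adj_mat A * A = det A \<cdot>\<^sub>m 1\<^sub>m n"
    using adj_mat[OF A] by auto
  then have inv: "adj_mat A * A = 1\<^sub>m n"
    using d by (auto intro!: eq_matI)
  have "det (adj_mat A) * det A = 1"
    using det_mult[OF adj A] inv by simp
  then have "adj_mat A \<in> carrier (special_linear_group TYPE('a) n)"
    using adj d by (simp add: special_linear_group_def)
  with inv show "\<exists>B\<in>carrier (special_linear_group TYPE('a) n).
      B \<otimes>\<^bsub>special_linear_group TYPE('a) n\<^esub> A = \<one>\<^bsub>special_linear_group TYPE('a) n\<^esub>"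
    by (auto simp: special_linear_group_def)
qed (auto simp: special_linear_group_def det_mult intro: assoc_mult_mat)

definition perfect_group :: "('a, 'b) monoid_scheme \<Rightarrow> bool" where
  "perfect_group G \<longleftrightarrow> group G \<and> derived G (carrier G) = carrier G"

definition subdirect_subgroup ::
    "('i \<Rightarrow> 'a) set \<Rightarrow> 'i set \<Rightarrow> ('i \<Rightarrow> ('a, 'b) monoid_scheme) \<Rightarrow> bool" where
  "subdirect_subgroup H I G \<longleftrightarrow>
     subgroup H (product_group I G) \<and> (\<forall>i\<in>I. (\<lambda>x. x i) ` H = carrier (G i))"

abbreviation direct_power :: "('a, 'b) monoid_scheme \<Rightarrow> nat \<Rightarrow> (nat \<Rightarrow> 'a) monoid" where
  "direct_power G m \<equiv> product_group {..<m} (\<lambda>_. G)"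

(* The indexing starts at 0, so that the trivial group gets nilpotency class 0. *)
primrec lower_central_series :: "('a, 'b) monoid_scheme \<Rightarrow> nat \<Rightarrow> 'a set" where
  "lower_central_series G 0 = carrier G"
| "lower_central_series G (Suc k) = generate G
     (\<Union>x\<in>lower_central_series G k. \<Union>y\<in>carrier G.
        {x \<otimes>\<^bsub>G\<^esub> y \<otimes>\<^bsub>G\<^esub> inv\<^bsub>G\<^esub> x \<otimes>\<^bsub>G\<^esub> inv\<^bsub>G\<^esub> y})"

definition nilpotent_group :: "('a, 'b) monoid_scheme \<Rightarrow> bool" where
  "nilpotent_group G \<longleftrightarrow> group G \<and> (\<exists>c. lower_central_series G c = {\<one>\<^bsub>G\<^esub>})"

(* Meaningful only for nilpotent groups. *)
definition nilpotency_class :: "('a, 'b) monoid_scheme \<Rightarrow> nat" where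
  "nilpotency_class G = (LEAST c. lower_central_series G c = {\<one>\<^bsub>G\<^esub>})"

end

theory Submission
  imports Defs "HOL-Number_Theory.Residues"
begin

text \<open>
  Let \<open>T\<close> be the ring of upper triangular \<open>n \<times> n\<close> matrices over the field with four elements whose
  diagonal is constant, and let \<open>G\<close> be the group generated by the elementary \<open>2 \<times> 2\<close> matrices over
  \<open>T\<close>, viewed inside \<open>SL_2n\<close>. It is perfect because conjugating an elementary matrix by
  \<open>diag(a, 1/a)\<close> scales its entry by \<open>a\<^sup>2 \<noteq> 1\<close>, and in characteristic 2 it contains \<open>diag(u, u)\<close>
  for every transvection \<open>u = 1 + e_{j,j+1}\<close>, as \<open>u\<^sup>2 = 1\<close>.

  Index the factors of the direct power by the points \<open>x\<close> of the cube \<open>{0,1}^{n-1}\<close> and consider families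
  of elements of \<open>G\<close> whose block entry at level \<open>(a, b)\<close> is a function of \<open>x_a, \<dots>, x_{b-1}\<close> only.
  Such a function is a multilinear polynomial, and taking the coefficient of \<open>x_a \<cdots> x_{b-1}\<close> in every
  block entry is multiplicative, since the entries \<open>(a, b)\<close> and \<open>(b, c)\<close> involve disjoint sets of
  variables. Let \<open>H\<close> be the group of those families whose matrix of top coefficients is
  \<open>A \<otimes> C\<close> with \<open>A\<close> of size 2 and \<open>C\<close> unipotent. It contains the constant families
  (where \<open>C = 1\<close>), hence is subdirect. Commutation raises the depth of \<open>C\<close>, so the \<open>(n-1)\<close>st term of the
  lower central series of \<open>H\<close> has \<open>C = 1\<close>, whereas the families \<open>x \<mapsto> diag(u, u)^{x_j}\<close> have
  \<open>C = 1 + e_{j,j+1}\<close>, and their iterated commutators have \<open>C = 1 + e_{0,c+1}\<close>.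
\<close>

section \<open>Quotients by the lower central series\<close>

text \<open>Conjugation sends the commutator of \<open>x\<close> and \<open>y\<close> to that of
  their conjugates. By induction the conjugate of \<open>x\<close> stays in the previous term, so
  the generating set is invariant under conjugation.\<close>

lemma (in group) lower_central_series_normal: "lower_central_series G k \<lhd> G"
proof (induction k)
  case 0
  show ?case
    by (simp add: normal_inv_iff subgroup_self)
next
  case (Suc k)
  let ?L = "lower_central_series G k"
  let ?S = "\<Union>x\<in>?L. \<Union>y\<in>carrier G. {x \<otimes> y \<otimes> inv x \<otimes> inv y}"
  have L: "subgroup ?L G" "\<And>g x. g \<in> carrier G \<Longrightarrow> x \<in> ?L \<Longrightarrow> g \<otimes> x \<otimes> inv g \<in> ?L"
    using Suc.IH by (auto simp: normal_inv_iff)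
  have Lc: "x \<in> carrier G" if "x \<in> ?L" for x
    using subgroup.subset[OF L(1)] that by auto
  have "generate G ?S \<lhd> G"
  proof (rule normal_generateI)
    show "?S \<subseteq> carrier G" using Lc by auto
  next
    fix h g assume "h \<in> ?S" and g: "g \<in> carrier G"
    then obtain x y where x: "x \<in> ?L" and y: "y \<in> carrier G"
      and h: "h = x \<otimes> y \<otimes> inv x \<otimes> inv y" by auto
    define x' y' where "x' = g \<otimes> x \<otimes> inv g" and "y' = g \<otimes> y \<otimes> inv g"
    have "x' \<in> ?L" "y' \<in> carrier G"
      using L(2)[OF g x] g y by (auto simp: x'_def y'_def)
    moreover have "inv g \<otimes> (g \<otimes> z) = z" if "z \<in> carrier G" for z
      using g that by (simp flip: m_assoc)
    then have "g \<otimes> h \<otimes> inv g = x' \<otimes> y' \<otimes> inv x' \<otimes> inv y'"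
      using g y Lc[OF x] by (simp add: h x'_def y'_def m_assoc inv_mult_group)
    ultimately show "g \<otimes> h \<otimes> inv g \<in> ?S" by blast
  qed
  then show ?case by simp
qed

text \<open>Homomorphisms commute with commutators and with generation. Surjectivity lets the second
  entry of the commutators range over all of \<open>H\<close>.\<close>

lemma (in group_hom) lower_central_series_image:
  assumes "h ` carrier G = carrier H"
  shows "lower_central_series H k = h ` lower_central_series G k"
proof (induction k)
  case 0
  show ?case using assms by simp
next
  case (Suc k)
  let ?L = "lower_central_series G k"
  have L: "?L \<subseteq> carrier G"
    using G.lower_central_series_normal[of k] by (simp add: normal_imp_subgroup subgroup.subset)
  have h: "h (x \<otimes> y \<otimes> inv x \<otimes> inv y)
      = h x \<otimes>\<^bsub>H\<^esub> h y \<otimes>\<^bsub>H\<^esub> inv\<^bsub>H\<^esub> h x \<otimes>\<^bsub>H\<^esub> inv\<^bsub>H\<^esub> h y"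
    if "x \<in> ?L" "y \<in> carrier G" for x y
    using that L by (auto simp: subset_iff)
  have "(\<Union>x\<in>h ` ?L. \<Union>y\<in>h ` carrier G. {x \<otimes>\<^bsub>H\<^esub> y \<otimes>\<^bsub>H\<^esub> inv\<^bsub>H\<^esub> x \<otimes>\<^bsub>H\<^esub> inv\<^bsub>H\<^esub> y})
      = h ` (\<Union>x\<in>?L. \<Union>y\<in>carrier G. {x \<otimes> y \<otimes> inv x \<otimes> inv y})"
    by (auto simp: image_UN h)
  moreover have "(\<Union>x\<in>?L. \<Union>y\<in>carrier G. {x \<otimes> y \<otimes> inv x \<otimes> inv y}) \<subseteq> carrier G"
    using L by auto
  ultimately show ?case
    using Suc.IH assms generate_img by simp
qed

lemma image_eq_singleton_iff: "A \<noteq> {} \<Longrightarrow> f ` A = {b} \<longleftrightarrow> (\<forall>a\<in>A. f a = b)"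
  by auto

text \<open>The series of the quotient is the image of the series of \<open>G\<close>, so its term
  \<open>c\<close> is trivial iff term \<open>c\<close> of \<open>G\<close> lies in term
  \<open>m\<close>. The hypothesis excludes this for \<open>c < m\<close>, which makes the class
  exactly \<open>m\<close>.\<close>

lemma (in group) Mod_lower_central_series:
  fixes m :: nat
  defines "Q \<equiv> G Mod lower_central_series G m"
  assumes "\<And>c. c < m \<Longrightarrow> \<not> lower_central_series G c \<subseteq> lower_central_series G m"
  shows "nilpotent_group Q" and "nilpotency_class Q = m"
proof -
  let ?N = "lower_central_series G m"
  interpret N: normal ?N G by (rule lower_central_series_normal)
  interpret Q: group Q unfolding Q_def by (rule N.factorgroup_is_group)
  interpret p: group_hom G Q "\<lambda>a. ?N #> a"
    unfolding Q_def by (rule group_hom.intro)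
      (auto intro: N.factorgroup_is_group N.r_coset_hom_Mod simp: group_hom_axioms_def)
  have one: "\<one>\<^bsub>Q\<^esub> = ?N" by (simp add: Q_def FactGroup_def)
  have "(\<lambda>a. ?N #> a) ` carrier G = carrier Q"
    by (auto simp: Q_def FactGroup_def RCOSETS_def)
  note img = p.lower_central_series_image[OF this]
  have iff: "lower_central_series Q c = {\<one>\<^bsub>Q\<^esub>} \<longleftrightarrow> lower_central_series G c \<subseteq> ?N" for c
  proof -
    interpret C: normal "lower_central_series G c" G by (rule lower_central_series_normal)
    have "?N #> a = ?N \<longleftrightarrow> a \<in> ?N" if "a \<in> carrier G" for a
      using that coset_join1[of ?N a] coset_join2[of a ?N] N.subgroup_axioms N.subset by blast
    moreover have "lower_central_series G c \<noteq> {}"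
      by (metis C.one_closed empty_iff)
    ultimately show ?thesis
      unfolding img one image_eq_singleton_iff[OF \<open>lower_central_series G c \<noteq> {}\<close>]
      using C.subset by blast
  qed
  have m: "lower_central_series Q m = {\<one>\<^bsub>Q\<^esub>}" by (simp add: iff)
  then show "nilpotent_group Q"
    unfolding nilpotent_group_def using Q.group_axioms by blast
  show "nilpotency_class Q = m"
    unfolding nilpotency_class_def using m assms(2) iff
    by (intro Least_equality) (auto simp: not_less[symmetric])
qed

section \<open>Arithmetic in characteristic 2\<close>

lemma char_2_if_card_4:
  assumes "CARD('a::field) = 4"
  shows "(1::'a) + 1 = 0"
proof -
  have "CHAR('a) dvd 4" using CHAR_dvd_CARD[where 'a = 'a] assms by simp
  then have "of_nat 4 = (0::'a)" by (simp only: of_nat_eq_0_iff_char_dvd)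
  then have "((1::'a) + 1) * (1 + 1) = 0" by simp
  then show ?thesis by (metis mult_eq_0_iff)
qed

lemma char_2_double:
  assumes "(1::'a::ring_1) + 1 = 0"
  shows "(x::'a) + x = 0" "- x = x"
proof -
  have "x + x = x * (1 + 1)" by (simp only: distrib_left mult_1_right)
  then show "x + x = 0" using assms by simp
  then show "- x = x" by (simp add: add_eq_0_iff2)
qed

section \<open>Top coefficients of families on the cube\<close>

text \<open>Clears all binary digits of \<open>x\<close> except those at the positions \<open>a, \<dots>, b - 1\<close>.\<close>

definition clip :: "nat \<Rightarrow> nat \<Rightarrow> nat \<Rightarrow> nat" where
  "clip a b x = 2 ^ a * (x div 2 ^ a mod 2 ^ (b - a))"

lemma clip_less: "b \<le> K \<Longrightarrow> a \<le> b \<Longrightarrow> clip a b x < 2 ^ K"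
proof -
  assume b: "b \<le> K" "a \<le> b"
  have "x div 2 ^ a mod 2 ^ (b - a) < (2::nat) ^ (b - a)" by simp
  then have "clip a b x < 2 ^ a * 2 ^ (b - a)" unfolding clip_def by simp
  also have "\<dots> = 2 ^ b" using b by (simp flip: power_add)
  also have "\<dots> \<le> 2 ^ K" using b by simp
  finally show ?thesis .
qed

text \<open>The window of digits from \<open>a\<close> to \<open>b - 1\<close> lies inside the one
  from \<open>a\<close> to \<open>c - 1\<close>, so clipping to the larger window first loses
  nothing. The next lemma does the same for the upper part of the window.\<close>

lemma clip_clip_left:
  assumes "a \<le> b" "b \<le> c"
  shows "clip a b (clip a c x) = clip a b x"
proof -
  have "(2::nat) ^ (b - a) dvd 2 ^ (c - a)" using assms by (intro le_imp_power_dvd) simp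
  then show ?thesis by (simp add: clip_def mod_mod_cancel)
qed

lemma clip_clip_right:
  assumes "a \<le> b" "b \<le> c"
  shows "clip b c (clip a c x) = clip b c x"
proof -
  have b: "(2::nat) ^ b = 2 ^ a * 2 ^ (b - a)" and c: "(2::nat) ^ (c - a) = 2 ^ (b - a) * 2 ^ (c - b)"
    using assms by (simp_all flip: power_add)
  have "x div 2 ^ a mod 2 ^ (c - a) div 2 ^ (b - a) = x div 2 ^ b mod 2 ^ (c - b)"
    by (simp add: c b mod_mult2_eq div_mult2_eq)
  then show ?thesis by (simp add: clip_def b div_mult2_eq)
qed

text \<open>Each \<open>m < p * q\<close> corresponds to the pair \<open>(m mod p, m div p)\<close>.
  For powers of 2 this splits the digits of \<open>m\<close> into a low and a high group, and the
  sum over a cube factors accordingly.\<close>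

lemma sum_lessThan_mult:
  fixes F :: "nat \<Rightarrow> 'a::comm_semiring_0"
  shows "(\<Sum>m<p * q. F (m mod p) * G (m div p)) = (\<Sum>u<p. F u) * (\<Sum>v<q. G v)"
proof (cases "p = 0")
  case False
  have "(\<Sum>m<p * q. F (m mod p) * G (m div p))
      = (\<Sum>v<q. \<Sum>m\<in>{v * p..<v * p + p}. F (m mod p) * G (m div p))"
    using sum.nat_group[of "\<lambda>m. F (m mod p) * G (m div p)" p q] by (simp add: mult.commute)
  also have "\<dots> = (\<Sum>v<q. \<Sum>u<p. F u * G v)"
  proof (rule sum.cong[OF refl])
    fix v
    have "(\<Sum>m\<in>{v * p..<v * p + p}. F (m mod p) * G (m div p))
        = (\<Sum>u\<in>{0..<p}. F ((u + v * p) mod p) * G ((u + v * p) div p))"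
      using sum.shift_bounds_nat_ivl[of "\<lambda>m. F (m mod p) * G (m div p)" 0 "v * p" p]
      by (simp add: add.commute)
    also have "\<dots> = (\<Sum>u<p. F u * G v)"
      using False by (intro sum.cong) auto
    finally show "(\<Sum>m\<in>{v * p..<v * p + p}. F (m mod p) * G (m div p)) = (\<Sum>u<p. F u * G v)" .
  qed
  also have "\<dots> = (\<Sum>u<p. F u) * (\<Sum>v<q. G v)"
    by (simp add: sum_product) (rule sum.swap)
  finally show ?thesis .
qed simp

text \<open>A point of the cube \<open>{0,1}^K\<close> is encoded by the number \<open>x < 2 ^ K\<close> with these binary digits, and
  \<open>l\<close> assigns levels to the row and column indices.\<close>

definition cube_family :: "nat \<Rightarrow> (nat \<Rightarrow> nat) \<Rightarrow> nat \<Rightarrow> (nat \<Rightarrow> 'a::comm_ring_1 mat) \<Rightarrow> bool" where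
  "cube_family N l K f \<longleftrightarrow> (\<forall>x<2 ^ K. f x \<in> carrier_mat N N \<and>
     (\<forall>i<N. \<forall>j<N. f x $$ (i, j) = (if l i \<le> l j then f (clip (l i) (l j) x) $$ (i, j) else 0)))"

text \<open>In characteristic 2 the coefficient of \<open>x_a \<cdots> x_{b-1}\<close> in a multilinear polynomial is the sum of
  its values on \<open>{0,1}^{b-a}\<close>. The sum is multiplicative over every ring.\<close>

definition top_coeff :: "nat \<Rightarrow> (nat \<Rightarrow> nat) \<Rightarrow> (nat \<Rightarrow> 'a::comm_ring_1 mat) \<Rightarrow> 'a mat" where
  "top_coeff N l f = mat N N (\<lambda>(i, j).
     if l i \<le> l j then \<Sum>m<2 ^ (l j - l i). f (2 ^ l i * m) $$ (i, j) else 0)"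

lemma cube_familyD:
  assumes "cube_family N l K f" "x < 2 ^ K"
  shows "f x \<in> carrier_mat N N"
    and "\<And>i j. i < N \<Longrightarrow> j < N \<Longrightarrow> l i \<le> l j \<Longrightarrow> f (clip (l i) (l j) x) $$ (i, j) = f x $$ (i, j)"
    and "\<And>i j. i < N \<Longrightarrow> j < N \<Longrightarrow> l j < l i \<Longrightarrow> f x $$ (i, j) = 0"
  using assms unfolding cube_family_def by (auto simp: not_le[symmetric])

lemma mult_mat_entry:
  assumes "A \<in> carrier_mat N N" "B \<in> carrier_mat N N" "i < N" "j < N"
  shows "(A * B) $$ (i, j) = (\<Sum>k<N. A $$ (i, k) * B $$ (k, j))"
  using assms by (simp add: scalar_prod_def lessThan_atLeast0)

text \<open>The index \<open>k\<close> contributes to entry \<open>(i, j)\<close> only if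
  \<open>l i \<le> l k\<close> and \<open>l k \<le> l j\<close>. Then the two factors depend on
  disjoint groups of digits, which together form the window of \<open>(i, j)\<close>, so the sum of
  their product over the cube is the product of the sums.\<close>

lemma cube_family_mult:
  assumes lK: "\<And>i. i < N \<Longrightarrow> l i \<le> K"
    and f: "cube_family N l K f" and g: "cube_family N l K g"
  shows "cube_family N l K (\<lambda>x. f x * g x)"
    and "top_coeff N l (\<lambda>x. f x * g x) = top_coeff N l f * top_coeff N l g"
proof -
  show "cube_family N l K (\<lambda>x. f x * g x)"
    unfolding cube_family_def
  proof (intro allI impI conjI)
    fix x :: nat assume x: "x < 2 ^ K"
    note F = cube_familyD[OF f x] and G = cube_familyD[OF g x]
    show "f x * g x \<in> carrier_mat N N" using F(1) G(1) by simp
    fix i j assume i: "i < N" and j: "j < N"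
    have e: "(f x * g x) $$ (i, j) = (\<Sum>k<N. f x $$ (i, k) * g x $$ (k, j))"
      by (rule mult_mat_entry[OF F(1) G(1) i j])
    show "(f x * g x) $$ (i, j)
        = (if l i \<le> l j then (f (clip (l i) (l j) x) * g (clip (l i) (l j) x)) $$ (i, j) else 0)"
    proof (cases "l i \<le> l j")
      case False
      have "f x $$ (i, k) * g x $$ (k, j) = 0" if "k < N" for k
        using F(3)[OF i that] G(3)[OF that j] False by fastforce
      then show ?thesis using False e by simp
    next
      case True
      let ?y = "clip (l i) (l j) x"
      have y: "?y < 2 ^ K" by (rule clip_less[OF lK[OF j] True])
      note F' = cube_familyD[OF f y] and G' = cube_familyD[OF g y]
      have "f x $$ (i, k) * g x $$ (k, j) = f ?y $$ (i, k) * g ?y $$ (k, j)" if k: "k < N" for k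
      proof (cases "l i \<le> l k \<and> l k \<le> l j")
        case True
        then have "f x $$ (i, k) = f ?y $$ (i, k)" "g x $$ (k, j) = g ?y $$ (k, j)"
          using F(2)[OF i k] F'(2)[OF i k] G(2)[OF k j] G'(2)[OF k j]
          by (auto simp: clip_clip_left clip_clip_right)
        then show ?thesis by simp
      next
        case False
        then show ?thesis using F(3)[OF i k] F'(3)[OF i k] G(3)[OF k j] G'(3)[OF k j] by fastforce
      qed
      then show ?thesis
        using True e mult_mat_entry[OF F'(1) G'(1) i j] by simp
    qed
  qed
  show "top_coeff N l (\<lambda>x. f x * g x) = top_coeff N l f * top_coeff N l g" (is "?L = ?R")
  proof (rule eq_matI)
    fix i j assume "i < dim_row ?R" "j < dim_col ?R"
    then have i: "i < N" and j: "j < N" by (auto simp: top_coeff_def)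
    have R: "?R $$ (i, j) = (\<Sum>k<N. top_coeff N l f $$ (i, k) * top_coeff N l g $$ (k, j))"
      using i j by (intro mult_mat_entry) (auto simp: top_coeff_def)
    show "?L $$ (i, j) = ?R $$ (i, j)"
    proof (cases "l i \<le> l j")
      case False
      have "top_coeff N l f $$ (i, k) * top_coeff N l g $$ (k, j) = 0" if "k < N" for k
        using that i j False by (auto simp: top_coeff_def)
      then show ?thesis using False R i j by (simp add: top_coeff_def)
    next
      case ij: True
      let ?x = "\<lambda>m. 2 ^ l i * m"
      \<comment> \<open>The points of the sum are fixed by clipping to the window of
        \<open>(i, j)\<close>, and the bound on clipped numbers puts them into the cube.\<close>
      have x: "?x m < 2 ^ K" "clip (l i) (l j) (?x m) = ?x m" if "m < 2 ^ (l j - l i)" for m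
      proof -
        show "clip (l i) (l j) (?x m) = ?x m" using that by (simp add: clip_def)
        then show "?x m < 2 ^ K" using clip_less[OF lK[OF j] ij, of "?x m"] by simp
      qed
      have "?L $$ (i, j) = (\<Sum>m<2 ^ (l j - l i). (f (?x m) * g (?x m)) $$ (i, j))"
        using i j ij by (simp add: top_coeff_def)
      also have "\<dots> = (\<Sum>m<2 ^ (l j - l i). \<Sum>k<N. f (?x m) $$ (i, k) * g (?x m) $$ (k, j))"
        using x i j cube_familyD(1)[OF f] cube_familyD(1)[OF g]
        by (intro sum.cong refl mult_mat_entry) auto
      also have "\<dots> = (\<Sum>k<N. \<Sum>m<2 ^ (l j - l i). f (?x m) $$ (i, k) * g (?x m) $$ (k, j))"
        by (rule sum.swap)
      also have "\<dots> = (\<Sum>k<N. top_coeff N l f $$ (i, k) * top_coeff N l g $$ (k, j))"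
      proof (rule sum.cong[OF refl])
        fix k assume "k \<in> {..<N}"
        then have k: "k < N" by simp
        show "(\<Sum>m<2 ^ (l j - l i). f (?x m) $$ (i, k) * g (?x m) $$ (k, j))
            = top_coeff N l f $$ (i, k) * top_coeff N l g $$ (k, j)"
        proof (cases "l i \<le> l k \<and> l k \<le> l j")
          case False
          then have "f (?x m) $$ (i, k) * g (?x m) $$ (k, j) = 0" if "m < 2 ^ (l j - l i)" for m
            using cube_familyD(3)[OF f x(1)[OF that] i k] cube_familyD(3)[OF g x(1)[OF that] k j]
            by fastforce
          moreover have "top_coeff N l f $$ (i, k) * top_coeff N l g $$ (k, j) = 0"
            using False i j k by (auto simp: top_coeff_def)
          ultimately show ?thesis by simp
        next
          case True
          let ?p = "2 ^ (l k - l i) :: nat" and ?q = "2 ^ (l j - l k) :: nat"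
          have pq: "2 ^ (l j - l i) = ?p * ?q" and lk: "(2::nat) ^ l k = 2 ^ l i * ?p"
            using True by (simp_all flip: power_add)
          \<comment> \<open>The low \<open>l k - l i\<close> digits of \<open>m\<close> are all that
            \<open>f\<close> sees at \<open>(i, k)\<close>; the remaining digits are all that
            \<open>g\<close> sees at \<open>(k, j)\<close>.\<close>
          have "f (?x m) $$ (i, k) * g (?x m) $$ (k, j)
              = f (?x (m mod ?p)) $$ (i, k) * g (2 ^ l k * (m div ?p)) $$ (k, j)"
            if m: "m < 2 ^ (l j - l i)" for m
          proof -
            have "m div ?p < ?q" using m pq by (simp add: less_mult_imp_div_less mult.commute)
            then have "clip (l k) (l j) (?x m) = 2 ^ l k * (m div ?p)"
              by (simp add: clip_def lk)
            moreover have "clip (l i) (l k) (?x m) = ?x (m mod ?p)"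
              by (simp add: clip_def)
            ultimately show ?thesis
              using cube_familyD(2)[OF f x(1)[OF m] i k] cube_familyD(2)[OF g x(1)[OF m] k j] True
              by simp
          qed
          then have "(\<Sum>m<2 ^ (l j - l i). f (?x m) $$ (i, k) * g (?x m) $$ (k, j))
              = (\<Sum>m<?p * ?q. f (?x (m mod ?p)) $$ (i, k) * g (2 ^ l k * (m div ?p)) $$ (k, j))"
            using pq by (intro sum.cong) auto
          also have "\<dots> = (\<Sum>u<?p. f (?x u) $$ (i, k)) * (\<Sum>v<?q. g (2 ^ l k * v) $$ (k, j))"
            by (rule sum_lessThan_mult)
          finally show ?thesis
            using True i j k by (simp add: top_coeff_def)
        qed
      qed
      finally show ?thesis using R by simp
    qed
  qed (auto simp: top_coeff_def)
qed

text \<open>Both notions evaluate the family only at numbers below \<open>2 ^ K\<close>. This allows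
  passing between pointwise formulas and elements of the direct power, which are
  \<open>undefined\<close> outside the index set.\<close>

lemma cube_family_cong:
  assumes lK: "\<And>i. i < N \<Longrightarrow> l i \<le> K"
    and eq: "\<And>x. x < 2 ^ K \<Longrightarrow> f x = g x"
  shows "cube_family N l K f \<longleftrightarrow> cube_family N l K g" and "top_coeff N l f = top_coeff N l g"
proof -
  have c: "f (clip (l i) (l j) x) = g (clip (l i) (l j) x)" if "i < N" "j < N" "l i \<le> l j" for i j x
    using that by (intro eq clip_less lK)
  show "cube_family N l K f \<longleftrightarrow> cube_family N l K g"
    unfolding cube_family_def using eq c by (simp cong: conj_cong imp_cong if_cong)
  have "f (2 ^ l i * m) = g (2 ^ l i * m)"
    if "i < N" "j < N" "l i \<le> l j" "m < 2 ^ (l j - l i)" for i j m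
    using c[of i j "2 ^ l i * m"] that by (simp add: clip_def)
  then show "top_coeff N l f = top_coeff N l g"
    unfolding top_coeff_def by (intro cong_mat) auto
qed

section \<open>Triangular and unipotent matrices\<close>

text \<open>The ring \<open>T\<close> of the overview. The constant diagonal is what makes the top
  coefficients of a constant family a scalar matrix.\<close>

definition const_diag_upper :: "nat \<Rightarrow> 'a::comm_ring_1 mat set" where
  "const_diag_upper n =
     {A \<in> carrier_mat n n. \<exists>\<alpha>. \<forall>i<n. \<forall>j\<le>i. A $$ (i, j) = (if i = j then \<alpha> else 0)}"

lemma const_diag_upper_carrier: "A \<in> const_diag_upper n \<Longrightarrow> A \<in> carrier_mat n n"
  by (simp add: const_diag_upper_def)

lemma const_diag_upper_add:
  assumes "A \<in> const_diag_upper n" "B \<in> const_diag_upper n"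
  shows "A + B \<in> const_diag_upper n"
proof -
  obtain \<alpha> \<beta> where "\<forall>i<n. \<forall>j\<le>i. A $$ (i, j) = (if i = j then \<alpha> else 0)"
    "\<forall>i<n. \<forall>j\<le>i. B $$ (i, j) = (if i = j then \<beta> else 0)"
    using assms by (auto simp: const_diag_upper_def)
  then have "\<forall>i<n. \<forall>j\<le>i. (A + B) $$ (i, j) = (if i = j then \<alpha> + \<beta> else 0)"
    using assms[THEN const_diag_upper_carrier] by auto
  then show ?thesis
    using assms unfolding const_diag_upper_def by auto
qed

lemma const_diag_upper_mult:
  assumes "A \<in> const_diag_upper n" "B \<in> const_diag_upper n"
  shows "A * B \<in> const_diag_upper n"
proof -
  note c = assms[THEN const_diag_upper_carrier]
  obtain \<alpha> \<beta> where A: "\<forall>i<n. \<forall>j\<le>i. A $$ (i, j) = (if i = j then \<alpha> else 0)"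
    and B: "\<forall>i<n. \<forall>j\<le>i. B $$ (i, j) = (if i = j then \<beta> else 0)"
    using assms by (auto simp: const_diag_upper_def)
  have "(A * B) $$ (i, j) = (if i = j then \<alpha> * \<beta> else 0)" if "i < n" "j \<le> i" for i j
  proof -
    have "(A * B) $$ (i, j) = (\<Sum>k<n. A $$ (i, k) * B $$ (k, j))"
      using c that by (intro mult_mat_entry) auto
    also have "\<dots> = (\<Sum>k<n. if k = i then \<alpha> * B $$ (i, j) else 0)"
    proof (intro sum.cong refl)
      fix k assume "k \<in> {..<n}"
      then show "A $$ (i, k) * B $$ (k, j) = (if k = i then \<alpha> * B $$ (i, j) else 0)"
        using A[rule_format, of i k] B[rule_format, of k j] that by (cases "k < i") auto
    qed
    also have "\<dots> = (if i = j then \<alpha> * \<beta> else 0)" using B that by simp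
    finally show ?thesis .
  qed
  then show ?thesis using c unfolding const_diag_upper_def by auto
qed

lemma const_diag_upper_smult_one: "\<alpha> \<cdot>\<^sub>m 1\<^sub>m n \<in> const_diag_upper n"
  by (auto simp: const_diag_upper_def)

lemma const_diag_upper_one: "1\<^sub>m n \<in> const_diag_upper n"
  by (auto simp: const_diag_upper_def)

lemma const_diag_upper_zero: "0\<^sub>m n n \<in> const_diag_upper n"
  by (auto simp: const_diag_upper_def)

lemma const_diag_upper_addrow_mat: "k < l \<Longrightarrow> addrow_mat n a k l \<in> const_diag_upper n"
  by (auto simp: const_diag_upper_def intro!: exI[of _ 1])

text \<open>With \<open>J\<close> the ideal of strictly upper triangular matrices, this is \<open>1 + J^k\<close> for \<open>k \<ge> 1\<close>.\<close>

definition unip :: "nat \<Rightarrow> nat \<Rightarrow> 'a::comm_ring_1 mat set" where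
  "unip n k = {C \<in> carrier_mat n n.
     \<forall>i<n. \<forall>j<n. j < i + k \<longrightarrow> C $$ (i, j) = (if i = j then 1 else 0)}"

lemma unipD:
  assumes "C \<in> unip n k"
  shows "C \<in> carrier_mat n n"
    and "i < n \<Longrightarrow> j < n \<Longrightarrow> j < i + k \<Longrightarrow> C $$ (i, j) = (if i = j then 1 else 0)"
  using assms by (auto simp: unip_def)

lemma unip_one: "1\<^sub>m n \<in> unip n k"
  by (auto simp: unip_def)

lemma unip_antimono: "k \<le> k' \<Longrightarrow> unip n k' \<subseteq> unip n k"
  unfolding unip_def by force

lemma unip_addrow_mat: "k + d \<le> l \<Longrightarrow> 0 < d \<Longrightarrow> addrow_mat n a k l \<in> unip n d"
  by (auto simp: unip_def)

text \<open>Write \<open>C = 1 + X\<close> and \<open>D = 1 + Y\<close> with \<open>X\<close> in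
  \<open>J^k\<close> and \<open>Y\<close> in \<open>J\<close>. The cross terms \<open>X * Y\<close>
  and \<open>Y * X\<close> lie in \<open>J^(k+1)\<close>, so in the range
  \<open>j < i + Suc k\<close> both products look like \<open>1 + X + Y\<close>.\<close>

lemma unip_mult_entry:
  assumes C: "C \<in> unip n k" and D: "D \<in> unip n 1" and k: "0 < k"
    and i: "i < n" and j: "j < n" and ij: "j < i + Suc k"
  shows "(C * D) $$ (i, j) = (if i = j then 1 else C $$ (i, j) + D $$ (i, j))"
    and "(D * C) $$ (i, j) = (if i = j then 1 else C $$ (i, j) + D $$ (i, j))"
proof -
  have "(C * D) $$ (i, j) = (\<Sum>m<n. C $$ (i, m) * D $$ (m, j))"
    using C D i j by (intro mult_mat_entry) (auto dest: unipD)
  also have "\<dots> = (\<Sum>m<n. (if m = i then D $$ (i, j) else 0)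
      + (if m = j then (if i = j then 0 else C $$ (i, j)) else 0))"
  proof (intro sum.cong refl)
    fix m assume "m \<in> {..<n}"
    then have m: "m < n" by simp
    show "C $$ (i, m) * D $$ (m, j) = (if m = i then D $$ (i, j) else 0)
        + (if m = j then (if i = j then 0 else C $$ (i, j)) else 0)"
      using unipD(2)[OF C i m] unipD(2)[OF D m j] k ij by (cases "m < i + k") auto
  qed
  also have "\<dots> = (if i = j then 1 else C $$ (i, j) + D $$ (i, j))"
    using unipD(2)[OF D i j] i j by (auto simp: sum.distrib)
  finally show "(C * D) $$ (i, j) = (if i = j then 1 else C $$ (i, j) + D $$ (i, j))" .
  have "(D * C) $$ (i, j) = (\<Sum>m<n. D $$ (i, m) * C $$ (m, j))"
    using C D i j by (intro mult_mat_entry) (auto dest: unipD)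
  also have "\<dots> = (\<Sum>m<n. (if m = i then (if i = j then 0 else C $$ (i, j)) else 0)
      + (if m = j then D $$ (i, j) else 0))"
  proof (intro sum.cong refl)
    fix m assume "m \<in> {..<n}"
    then have m: "m < n" by simp
    show "D $$ (i, m) * C $$ (m, j) = (if m = i then (if i = j then 0 else C $$ (i, j)) else 0)
        + (if m = j then D $$ (i, j) else 0)"
      using unipD(2)[OF D i m] unipD(2)[OF C m j] k ij by (cases "m \<le> i") auto
  qed
  also have "\<dots> = (if i = j then 1 else C $$ (i, j) + D $$ (i, j))"
    using unipD(2)[OF D i j] i j by (auto simp: sum.distrib)
  finally show "(D * C) $$ (i, j) = (if i = j then 1 else C $$ (i, j) + D $$ (i, j))" .
qed

lemma unip_mult:
  assumes "C \<in> unip n k" "D \<in> unip n k" "0 < k"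
  shows "C * D \<in> unip n k"
proof -
  have D: "D \<in> unip n 1" using assms unip_antimono[of 1 k n] by auto
  have "(C * D) $$ (i, j) = (if i = j then 1 else 0)" if "i < n" "j < n" "j < i + k" for i j
    using unip_mult_entry(1)[OF assms(1) D assms(3) that(1,2)] that
      unipD(2)[OF assms(1) that] unipD(2)[OF assms(2) that] by simp
  then show ?thesis using assms by (auto simp: unip_def)
qed

text \<open>Agreement of \<open>X\<close> and \<open>Y\<close> in the entries with
  \<open>j < i + k\<close> survives right multiplication by the upper triangular \<open>Z\<close>,
  so there \<open>X * Z\<close> agrees with \<open>Y * Z\<close>, the identity.\<close>

lemma unip_mult_right_inverse:
  assumes "X \<in> carrier_mat n n" "Y \<in> carrier_mat n n" "Z \<in> unip n 1" "Y * Z = 1\<^sub>m n"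
    and XY: "\<And>i j. i < n \<Longrightarrow> j < n \<Longrightarrow> j < i + k \<Longrightarrow> X $$ (i, j) = Y $$ (i, j)"
  shows "X * Z \<in> unip n k"
proof -
  have Z: "Z \<in> carrier_mat n n" using assms by (auto dest: unipD)
  have "(X * Z) $$ (i, j) = (if i = j then 1 else 0)" if i: "i < n" and j: "j < n" and "j < i + k" for i j
  proof -
    have "(X * Z) $$ (i, j) = (\<Sum>m<n. X $$ (i, m) * Z $$ (m, j))"
      using assms Z i j by (intro mult_mat_entry) auto
    also have "\<dots> = (\<Sum>m<n. Y $$ (i, m) * Z $$ (m, j))"
    proof (intro sum.cong refl)
      fix m assume "m \<in> {..<n}"
      then show "X $$ (i, m) * Z $$ (m, j) = Y $$ (i, m) * Z $$ (m, j)"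
        using XY[of i m] unipD(2)[OF assms(3), of m j] that by (cases "m \<le> j") auto
    qed
    also have "\<dots> = (Y * Z) $$ (i, j)"
      using assms Z i j by (intro mult_mat_entry[symmetric]) auto
    finally show ?thesis using assms(4) i j by simp
  qed
  then show ?thesis using assms Z by (auto simp: unip_def)
qed

lemma mult_4_inverse:
  assumes "C \<in> carrier_mat n n" "D \<in> carrier_mat n n" "C' \<in> carrier_mat n n" "D' \<in> carrier_mat n n"
    and "C * C' = 1\<^sub>m n" "D * D' = (1\<^sub>m n :: 'a::comm_ring_1 mat)"
  shows "(D * C) * (C' * D') = 1\<^sub>m n"
proof -
  have "(D * C) * (C' * D') = D * (C * C' * D')"
    using assms(1-4) by (simp add: assoc_mult_mat[of _ n n _ n _ n])
  then show ?thesis using assms by simp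
qed

text \<open>\<open>C * D\<close> and \<open>D * C\<close> agree up to \<open>J^(k+1)\<close>, and
  \<open>C' * D'\<close> is the inverse of \<open>D * C\<close>. The second conclusion concerns the
  inverse of the first commutator, as elements are tracked together with their inverses.\<close>

lemma unip_commutator:
  assumes C: "C \<in> unip n k" and D: "D \<in> unip n 1" and k: "0 < k"
    and C': "C' \<in> unip n 1" and D': "D' \<in> unip n 1"
    and inv: "C * C' = 1\<^sub>m n" "D * D' = 1\<^sub>m n"
  shows "C * D * C' * D' \<in> unip n (Suc k)" and "D * C * D' * C' \<in> unip n (Suc k)"
proof -
  note c = unipD(1)[OF C] unipD(1)[OF D] unipD(1)[OF C'] unipD(1)[OF D']
  have eq: "(C * D) $$ (i, j) = (D * C) $$ (i, j)" if "i < n" "j < n" "j < i + Suc k" for i j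
    using unip_mult_entry[OF C D k that] by simp
  have "(C * D) * (C' * D') \<in> unip n (Suc k)"
    using c eq by (intro unip_mult_right_inverse[of _ n "D * C"] unip_mult C' D' mult_4_inverse inv) auto
  moreover have "(D * C) * (D' * C') \<in> unip n (Suc k)"
    using c eq by (intro unip_mult_right_inverse[of _ n "C * D"] unip_mult C' D' mult_4_inverse inv) auto
  ultimately show "C * D * C' * D' \<in> unip n (Suc k)" "D * C * D' * C' \<in> unip n (Suc k)"
    using c by (simp_all add: assoc_mult_mat[of _ n n _ n _ n])
qed

lemma mult_smult_smult:
  assumes "C \<in> carrier_mat n n" "D \<in> carrier_mat n n"
  shows "(\<alpha> \<cdot>\<^sub>m C) * (\<beta> \<cdot>\<^sub>m D) = (\<alpha> * \<beta> :: 'a::comm_ring_1) \<cdot>\<^sub>m (C * D)"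
  using assms by (intro eq_matI) (auto simp: scalar_prod_def sum_distrib_left algebra_simps)

section \<open>Families of block matrices\<close>

lemma block_entry:
  assumes "p \<in> carrier_mat n n" "q \<in> carrier_mat n n" "r \<in> carrier_mat n n" "s \<in> carrier_mat n n"
    and "i < 2 * n" "j < 2 * n"
  shows "four_block_mat p q r s $$ (i, j)
    = (if i < n then if j < n then p else q else if j < n then r else s) $$ (i mod n, j mod n)"
  using assms by (simp add: le_mod_geq)

text \<open>The level function \<open>i mod n\<close> gives all four blocks the same levels, so
  every condition can be checked block by block.\<close>

lemma cube_family_four_block:
  assumes p: "cube_family n (\<lambda>i. i) K p" and q: "cube_family n (\<lambda>i. i) K q"
    and r: "cube_family n (\<lambda>i. i) K r" and s: "cube_family n (\<lambda>i. i) K s" and nK: "n \<le> Suc K"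
  shows "cube_family (2 * n) (\<lambda>i. i mod n) K (\<lambda>x. four_block_mat (p x) (q x) (r x) (s x))"
      (is "cube_family _ ?l _ ?f")
    and "top_coeff (2 * n) (\<lambda>i. i mod n) (\<lambda>x. four_block_mat (p x) (q x) (r x) (s x))
      = four_block_mat (top_coeff n (\<lambda>i. i) p) (top_coeff n (\<lambda>i. i) q)
          (top_coeff n (\<lambda>i. i) r) (top_coeff n (\<lambda>i. i) s)"
proof -
  note c = cube_familyD(1)[OF p] cube_familyD(1)[OF q] cube_familyD(1)[OF r] cube_familyD(1)[OF s]
  have e: "?f x $$ (i, j)
      = (if i < n then if j < n then p x else q x else if j < n then r x else s x) $$ (i mod n, j mod n)"
    if "x < 2 ^ K" "i < 2 * n" "j < 2 * n" for x i j
    using that c by (intro block_entry) auto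
  have z: "clip (i mod n) (j mod n) x < 2 ^ K" if "i < 2 * n" "i mod n \<le> j mod n" for x i j
  proof (rule clip_less)
    have "j mod n < n" using that by simp
    then show "j mod n \<le> K" using nK by simp
  qed (use that in auto)
  show "cube_family (2 * n) ?l K ?f"
    unfolding cube_family_def
  proof (intro allI impI conjI)
    fix x :: nat assume x: "x < 2 ^ K"
    show "?f x \<in> carrier_mat (2 * n) (2 * n)" using c x by (simp add: mult_2)
    fix i j assume i: "i < 2 * n" and j: "j < 2 * n"
    have n: "i mod n < n" "j mod n < n" using i by auto
    show "?f x $$ (i, j) = (if ?l i \<le> ?l j then ?f (clip (?l i) (?l j) x) $$ (i, j) else 0)"
      using e[OF x i j] e[OF z[OF i] i j] cube_familyD(2,3)[OF p x n] cube_familyD(2,3)[OF q x n]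
        cube_familyD(2,3)[OF r x n] cube_familyD(2,3)[OF s x n] by auto
  qed
  show "top_coeff (2 * n) ?l ?f = four_block_mat (top_coeff n (\<lambda>i. i) p) (top_coeff n (\<lambda>i. i) q)
      (top_coeff n (\<lambda>i. i) r) (top_coeff n (\<lambda>i. i) s)" (is "_ = ?R")
  proof (rule eq_matI)
    fix i j assume "i < dim_row ?R" "j < dim_col ?R"
    then have i: "i < 2 * n" and j: "j < 2 * n" by (auto simp: top_coeff_def)
    have n: "i mod n < n" "j mod n < n" using i by auto
    have "?R $$ (i, j) = (if i < n then if j < n then top_coeff n (\<lambda>i. i) p else top_coeff n (\<lambda>i. i) q
        else if j < n then top_coeff n (\<lambda>i. i) r else top_coeff n (\<lambda>i. i) s) $$ (i mod n, j mod n)"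
      using i j by (intro block_entry) (auto simp: top_coeff_def)
    moreover have "?f (2 ^ (i mod n) * m) $$ (i, j)
      = (if i < n then if j < n then p (2 ^ (i mod n) * m) else q (2 ^ (i mod n) * m)
          else if j < n then r (2 ^ (i mod n) * m) else s (2 ^ (i mod n) * m)) $$ (i mod n, j mod n)"
      if "i mod n \<le> j mod n" "m < 2 ^ (j mod n - i mod n)" for m
    proof (rule e[OF _ i j])
      show "2 ^ (i mod n) * m < 2 ^ K"
        using z[OF i that(1), of "2 ^ (i mod n) * m"] that by (simp add: clip_def)
    qed
    ultimately show "top_coeff (2 * n) ?l ?f $$ (i, j) = ?R $$ (i, j)"
      using i j n by (simp add: top_coeff_def)
  qed (auto simp: top_coeff_def)
qed

lemma cube_family_const:
  assumes "A \<in> const_diag_upper n"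
  shows "cube_family n (\<lambda>i. i) K (\<lambda>_. A)"
  using assms by (fastforce simp: cube_family_def const_diag_upper_def not_le)

text \<open>Above the diagonal a constant is summed over \<open>2 ^ (j - i)\<close> points, an even
  number, which gives 0. On the diagonal there is a single summand \<alpha>.\<close>

lemma top_coeff_const:
  assumes "A \<in> const_diag_upper n" and char2: "(1::'a::comm_ring_1) + 1 = 0"
  shows "\<exists>\<alpha>::'a. top_coeff n (\<lambda>i. i) (\<lambda>_. A) = \<alpha> \<cdot>\<^sub>m 1\<^sub>m n"
proof -
  obtain \<alpha> where A: "\<forall>i<n. \<forall>j\<le>i. A $$ (i, j) = (if i = j then \<alpha> else 0)"
    using assms(1) by (auto simp: const_diag_upper_def)
  have two: "(2::'a) = 0" using char2 by simp
  have "top_coeff n (\<lambda>i. i) (\<lambda>_. A) $$ (i, j) = (\<alpha> \<cdot>\<^sub>m 1\<^sub>m n) $$ (i, j)" if "i < n" "j < n" for i j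
    using that A by (cases i j rule: linorder_cases) (auto simp: top_coeff_def two power_0_left)
  then show ?thesis
    by (intro exI[of _ \<alpha>] eq_matI) (auto simp: top_coeff_def)
qed

text \<open>\<open>addrow_mat n a k l\<close> is the transvection \<open>1 + a e_{k,l}\<close>. The
  entry at \<open>(j, j + 1)\<close> is the digit \<open>x_j\<close>, whose window is exactly that
  digit, and its sum over the two values is 1.\<close>

lemma cube_family_addrow_mat:
  fixes j n :: nat and f :: "nat \<Rightarrow> 'a::comm_ring_1 mat"
  defines "f \<equiv> \<lambda>x. addrow_mat n (of_bool (odd (x div 2 ^ j))) j (Suc j)"
  shows "cube_family n (\<lambda>i. i) K f"
    and "top_coeff n (\<lambda>i. i) f = addrow_mat n 1 j (Suc j)"
proof -
  have "odd (clip j (Suc j) x div 2 ^ j) \<longleftrightarrow> odd (x div 2 ^ j)" for x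
    by (simp add: clip_def)
  then show "cube_family n (\<lambda>i. i) K f"
    by (auto simp: cube_family_def f_def)
  have "(\<Sum>m<2::nat. of_bool (odd (2 ^ j * m div 2 ^ j)) :: 'a) = 1"
    by (simp add: numeral_2_eq_2)
  moreover have "f x $$ (i, k) = (if i = k then 1 else 0)"
    if "i < n" "k < n" "\<not> (j = i \<and> k = Suc j)" for x i k
    using that by (auto simp: f_def)
  ultimately have "top_coeff n (\<lambda>i. i) f $$ (i, k) = addrow_mat n 1 j (Suc j) $$ (i, k)"
    if "i < n" "k < n" for i k
    using that by (cases "j = i \<and> k = Suc j") (auto simp: top_coeff_def, auto simp: f_def)
  then show "top_coeff n (\<lambda>i. i) f = addrow_mat n 1 j (Suc j)"
    by (intro eq_matI) (auto simp: top_coeff_def)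
qed

section \<open>Transvections in characteristic 2\<close>

lemma addrow_mat_mult_self:
  assumes "k < n" "l < n" "k \<noteq> l" and char2: "(1::'a::comm_ring_1) + 1 = 0"
  shows "addrow_mat n (a::'a) k l * addrow_mat n a k l = 1\<^sub>m n"
  using addrow_mat_inv[OF assms(1-3), of a] char_2_double(2)[OF char2, of a] by simp

text \<open>The Steinberg relation for \<open>e_{a,b}\<close> and \<open>e_{b,c}\<close>. In
  characteristic 2 transvections are their own inverses and signs vanish, so both orders give the
  same result.\<close>

lemma addrow_mat_commutator:
  assumes "a < b" "b < c" "c < n" and char2: "(1::'a::comm_ring_1) + 1 = 0"
  defines "X \<equiv> addrow_mat n (1::'a) a b" and "Y \<equiv> addrow_mat n (1::'a) b c"
  shows "X * Y * X * Y = addrow_mat n 1 a c" and "Y * X * Y * X = addrow_mat n 1 a c"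
proof -
  have XY: "X \<in> carrier_mat n n" "Y \<in> carrier_mat n n" by (auto simp: X_def Y_def)
  have "1 + (1 + x) = x" for x :: 'a using char2 by (simp flip: add.assoc)
  note s = this char_2_double[OF char2] char2
  \<comment> \<open>Left multiplication by a transvection is a row operation, which reduces the
    products to an entrywise computation.\<close>
  have aX: "X * M = addrow 1 a b M" and aY: "Y * M = addrow 1 b c M" if "M \<in> carrier_mat n n" for M
    using that assms(1-3) unfolding X_def Y_def by (simp_all add: addrow_mat)
  have "X * Y * X * Y = X * (Y * (X * Y))"
    using XY by (simp add: assoc_mult_mat[of _ n n _ n _ n])
  also have "\<dots> = addrow 1 a b (addrow 1 b c (addrow 1 a b Y))"
    using XY by (simp add: aX aY)
  also have "\<dots> = addrow_mat n 1 a c"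
    unfolding Y_def using assms(1-3) s by (intro eq_matI) auto
  finally show "X * Y * X * Y = addrow_mat n 1 a c" .
  have "Y * X * Y * X = Y * (X * (Y * X))"
    using XY by (simp add: assoc_mult_mat[of _ n n _ n _ n])
  also have "\<dots> = addrow 1 b c (addrow 1 a b (addrow 1 b c X))"
    using XY by (simp add: aX aY)
  also have "\<dots> = addrow_mat n 1 a c"
    unfolding X_def using assms(1-3) s by (intro eq_matI) auto
  finally show "Y * X * Y * X = addrow_mat n 1 a c" .
qed

section \<open>Block families whose top coefficients form a Kronecker product\<close>

definition block_family :: "nat \<Rightarrow> (nat \<Rightarrow> 'a::comm_ring_1 mat) \<Rightarrow> bool" where
  "block_family n = cube_family (2 * n) (\<lambda>i. i mod n) (n - 1)"

definition block_top :: "nat \<Rightarrow> (nat \<Rightarrow> 'a::comm_ring_1 mat) \<Rightarrow> 'a mat" where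
  "block_top n = top_coeff (2 * n) (\<lambda>i. i mod n)"

text \<open>Levels run from 0 to \<open>n - 1\<close>; hence a cube of dimension
  \<open>n - 1\<close>, with one digit for each step between consecutive levels.\<close>

lemma block_level_le: "i < 2 * n \<Longrightarrow> i mod n \<le> n - (1::nat)"
  using mod_less_divisor[of n i] by (cases n) auto

lemma block_family_mult:
  assumes "block_family n f" "block_family n g"
  shows "block_family n (\<lambda>x. f x * g x)"
    and "block_top n (\<lambda>x. f x * g x) = block_top n f * block_top n g"
  using cube_family_mult[OF _ assms[unfolded block_family_def]] block_level_le
  unfolding block_family_def block_top_def by blast+

lemma block_family_cong:
  assumes "\<And>x. x < 2 ^ (n - 1) \<Longrightarrow> f x = g x"
  shows "block_family n f \<longleftrightarrow> block_family n g" and "block_top n f = block_top n g"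
proof -
  show "block_family n f \<longleftrightarrow> block_family n g"
    unfolding block_family_def by (rule cube_family_cong(1), erule block_level_le, erule assms)
  show "block_top n f = block_top n g"
    unfolding block_top_def by (rule cube_family_cong(2), erule block_level_le, erule assms)
qed

text \<open>\<open>M\<close> is a Kronecker product \<open>A \<otimes> C\<close> with \<open>A\<close> of size 2.\<close>

definition twisted :: "nat \<Rightarrow> 'a::comm_ring_1 mat \<Rightarrow> 'a mat \<Rightarrow> bool" where
  "twisted n C M \<longleftrightarrow> (\<exists>\<alpha> \<beta> \<gamma> \<delta>. M = four_block_mat (\<alpha> \<cdot>\<^sub>m C) (\<beta> \<cdot>\<^sub>m C) (\<gamma> \<cdot>\<^sub>m C) (\<delta> \<cdot>\<^sub>m C))"

text \<open>The mixed product rule for Kronecker products: the factors of size 2 and the factors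
  \<open>C\<close>, \<open>D\<close> multiply separately.\<close>

lemma twisted_mult:
  assumes CD: "C \<in> carrier_mat n n" "D \<in> carrier_mat n n" and M: "twisted n C M" "twisted n D M'"
  shows "twisted n (C * D) (M * M')"
proof -
  obtain \<alpha> \<beta> \<gamma> \<delta> \<alpha>' \<beta>' \<gamma>' \<delta>'
    where M: "M = four_block_mat (\<alpha> \<cdot>\<^sub>m C) (\<beta> \<cdot>\<^sub>m C) (\<gamma> \<cdot>\<^sub>m C) (\<delta> \<cdot>\<^sub>m C)"
      "M' = four_block_mat (\<alpha>' \<cdot>\<^sub>m D) (\<beta>' \<cdot>\<^sub>m D) (\<gamma>' \<cdot>\<^sub>m D) (\<delta>' \<cdot>\<^sub>m D)"
    using M unfolding twisted_def by blast
  have "M * M' = four_block_mat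
      ((\<alpha> * \<alpha>' + \<beta> * \<gamma>') \<cdot>\<^sub>m (C * D)) ((\<alpha> * \<beta>' + \<beta> * \<delta>') \<cdot>\<^sub>m (C * D))
      ((\<gamma> * \<alpha>' + \<delta> * \<gamma>') \<cdot>\<^sub>m (C * D)) ((\<gamma> * \<beta>' + \<delta> * \<delta>') \<cdot>\<^sub>m (C * D))"
    unfolding M using CD
    by (subst mult_four_block_mat[of _ n n _ n _ n _ _ n _ n])
      (auto simp: mult_smult_smult[OF CD] add_smult_distrib_right_mat[of _ n n])
  then show ?thesis unfolding twisted_def by blast
qed

text \<open>The intended \<open>h'\<close> is the pointwise inverse of \<open>h\<close>; treating both on the same footing makes closure
  under inversion trivial.\<close>

definition unip_top :: "nat \<Rightarrow> nat \<Rightarrow> (nat \<Rightarrow> 'a::comm_ring_1 mat) \<Rightarrow> (nat \<Rightarrow> 'a mat) \<Rightarrow> bool" where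
  "unip_top n k h h' \<longleftrightarrow> block_family n h \<and> block_family n h' \<and>
     (\<exists>C\<in>unip n (Suc k). \<exists>C'\<in>unip n (Suc k). C * C' = 1\<^sub>m n \<and> C' * C = 1\<^sub>m n \<and>
        twisted n C (block_top n h) \<and> twisted n C' (block_top n h'))"

lemma unip_topI:
  assumes "block_family n h" "block_family n h'" "C \<in> unip n (Suc k)" "C' \<in> unip n (Suc k)"
    and "C * C' = 1\<^sub>m n" "C' * C = 1\<^sub>m n"
    and "twisted n C (block_top n h)" "twisted n C' (block_top n h')"
  shows "unip_top n k h h'"
  using assms unfolding unip_top_def by blast

lemma unip_top_sym: "unip_top n k h h' \<Longrightarrow> unip_top n k h' h"
  unfolding unip_top_def by blast

lemma unip_top_antimono: "k \<le> k' \<Longrightarrow> unip_top n k' h h' \<Longrightarrow> unip_top n k h h'"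
  using unip_antimono[of "Suc k" "Suc k'" n] unfolding unip_top_def by blast

lemma unip_top_cong:
  assumes "\<And>x. x < 2 ^ (n - 1) \<Longrightarrow> f x = g x" "\<And>x. x < 2 ^ (n - 1) \<Longrightarrow> f' x = g' x"
  shows "unip_top n k f f' \<longleftrightarrow> unip_top n k g g'"
  using block_family_cong[of n f g, OF assms(1)] block_family_cong[of n f' g', OF assms(2)]
  unfolding unip_top_def by simp

lemma unip_top_mult:
  assumes h: "unip_top n k h h'" and g: "unip_top n k g g'"
  shows "unip_top n k (\<lambda>x. h x * g x) (\<lambda>x. g' x * h' x)"
proof -
  obtain C C' where C: "C \<in> unip n (Suc k)" "C' \<in> unip n (Suc k)"
    "C * C' = 1\<^sub>m n" "C' * C = 1\<^sub>m n" "twisted n C (block_top n h)" "twisted n C' (block_top n h')"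
    using h unfolding unip_top_def by blast
  obtain D D' where D: "D \<in> unip n (Suc k)" "D' \<in> unip n (Suc k)"
    "D * D' = 1\<^sub>m n" "D' * D = 1\<^sub>m n" "twisted n D (block_top n g)" "twisted n D' (block_top n g')"
    using g unfolding unip_top_def by blast
  note c = unipD(1)[OF C(1)] unipD(1)[OF C(2)] unipD(1)[OF D(1)] unipD(1)[OF D(2)]
  have f: "block_family n h" "block_family n h'" "block_family n g" "block_family n g'"
    using h g unfolding unip_top_def by auto
  show ?thesis
  proof (rule unip_topI)
    show "C * D \<in> unip n (Suc k)" "D' * C' \<in> unip n (Suc k)"
      using C D by (auto intro: unip_mult)
    show "C * D * (D' * C') = 1\<^sub>m n" "D' * C' * (C * D) = 1\<^sub>m n"
      using mult_4_inverse[of D n C D' C'] mult_4_inverse[of C' n D' C D] c C D by auto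
  qed (use f c C D in \<open>auto simp: block_family_mult intro: twisted_mult\<close>)
qed

lemma commutator_mult_swapped:
  assumes "X \<in> carrier_mat n n" "Y \<in> carrier_mat n n" "X' \<in> carrier_mat n n" "Y' \<in> carrier_mat n n"
    and "X * X' = 1\<^sub>m n" "Y * Y' = 1\<^sub>m n" "X' * X = 1\<^sub>m n" "Y' * Y = (1\<^sub>m n :: 'a::comm_ring_1 mat)"
  shows "X * Y * X' * Y' * (Y * X * Y' * X') = 1\<^sub>m n"
proof -
  have "X * Y * X' * Y' * (Y * X * Y' * X') = (X * Y) * ((X' * (Y' * Y) * X) * (Y' * X'))"
    using assms(1-4) by (simp add: assoc_mult_mat[of _ n n _ n _ n])
  also have "\<dots> = (X * Y) * (Y' * X')" using assms by simp
  also have "\<dots> = 1\<^sub>m n" using assms by (intro mult_4_inverse)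
  finally show ?thesis .
qed

text \<open>Top coefficients are multiplicative, so the \<open>C\<close>-part of the commutator is
  the commutator of the \<open>C\<close>-parts, which is one step deeper; the factor of size 2 is
  left arbitrary. Index \<open>k\<close> stands for \<open>1 + J^(k+1)\<close>, matching a lower
  central series that starts at 0.\<close>

lemma unip_top_commutator:
  assumes h: "unip_top n k h h'" and g: "unip_top n 0 g g'"
  shows "unip_top n (Suc k) (\<lambda>x. h x * g x * h' x * g' x) (\<lambda>x. g x * h x * g' x * h' x)"
proof -
  obtain C C' where C: "C \<in> unip n (Suc k)" "C' \<in> unip n (Suc k)"
    "C * C' = 1\<^sub>m n" "C' * C = 1\<^sub>m n" "twisted n C (block_top n h)" "twisted n C' (block_top n h')"
    using h unfolding unip_top_def by blast
  obtain D D' where D: "D \<in> unip n (Suc 0)" "D' \<in> unip n (Suc 0)"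
    "D * D' = 1\<^sub>m n" "D' * D = 1\<^sub>m n" "twisted n D (block_top n g)" "twisted n D' (block_top n g')"
    using g unfolding unip_top_def by blast
  note c = unipD(1)[OF C(1)] unipD(1)[OF C(2)] unipD(1)[OF D(1)] unipD(1)[OF D(2)]
  have f: "block_family n h" "block_family n h'" "block_family n g" "block_family n g'"
    using h g unfolding unip_top_def by auto
  have 1: "C' \<in> unip n 1" "D \<in> unip n 1" "D' \<in> unip n 1"
    using C(2) D(1,2) unip_antimono[of 1 "Suc k" n] by auto
  show ?thesis
  proof (rule unip_topI)
    show "C * D * C' * D' \<in> unip n (Suc (Suc k))" "D * C * D' * C' \<in> unip n (Suc (Suc k))"
      using unip_commutator[OF C(1) 1(2) _ 1(1,3) C(3) D(3)] by auto
    show "C * D * C' * D' * (D * C * D' * C') = 1\<^sub>m n"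
      "D * C * D' * C' * (C * D * C' * D') = 1\<^sub>m n"
      using c C D by (intro commutator_mult_swapped; simp)+
    have eq: "block_top n (\<lambda>x. p x * q x * p' x * q' x)
        = block_top n p * block_top n q * block_top n p' * block_top n q'"
      if "block_family n p" "block_family n q" "block_family n p'" "block_family n q'"
      for p q p' q' :: "nat \<Rightarrow> 'a mat"
      using that by (simp add: block_family_mult)
    show "twisted n (C * D * C' * D') (block_top n (\<lambda>x. h x * g x * h' x * g' x))"
      unfolding eq[OF f(1,3,2,4)] using c C D by (intro twisted_mult mult_carrier_mat)
    show "twisted n (D * C * D' * C') (block_top n (\<lambda>x. g x * h x * g' x * h' x))"
      unfolding eq[OF f(3,1,4,2)] using c C D by (intro twisted_mult mult_carrier_mat)
  qed (use f in \<open>auto simp: block_family_mult\<close>)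
qed

section \<open>The elementary group\<close>

lemma four_block_mult:
  assumes "A \<in> carrier_mat n n" "B \<in> carrier_mat n n" "C \<in> carrier_mat n n" "D \<in> carrier_mat n n"
    "A' \<in> carrier_mat n n" "B' \<in> carrier_mat n n" "C' \<in> carrier_mat n n" "D' \<in> carrier_mat n n"
  shows "four_block_mat A B C D * four_block_mat A' B' C' D'
    = four_block_mat (A * A' + B * C') (A * B' + B * D') (C * A' + D * C') (C * B' + D * D')"
  using assms by (rule mult_four_block_mat)

lemma mat_double_char_2:
  assumes "A \<in> carrier_mat n n" "(1::'a::comm_ring_1) + 1 = 0"
  shows "A + A = (0\<^sub>m n n :: 'a mat)"
  using assms(1) char_2_double(1)[OF assms(2)] by (intro eq_matI) auto

definition upper_elem :: "nat \<Rightarrow> 'a::comm_ring_1 mat \<Rightarrow> 'a mat" where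
  "upper_elem n r = four_block_mat (1\<^sub>m n) r (0\<^sub>m n n) (1\<^sub>m n)"

definition lower_elem :: "nat \<Rightarrow> 'a::comm_ring_1 mat \<Rightarrow> 'a mat" where
  "lower_elem n r = four_block_mat (1\<^sub>m n) (0\<^sub>m n n) r (1\<^sub>m n)"

definition block_diag :: "nat \<Rightarrow> 'a::comm_ring_1 mat \<Rightarrow> 'a mat \<Rightarrow> 'a mat" where
  "block_diag n u v = four_block_mat u (0\<^sub>m n n) (0\<^sub>m n n) v"

lemma elem_mult:
  assumes "r \<in> carrier_mat n n" "s \<in> carrier_mat n n"
  shows "upper_elem n r * upper_elem n s = upper_elem n (r + s)"
    and "lower_elem n r * lower_elem n s = lower_elem n (r + s)"
  using assms comm_add_mat[of r n n s]
  by (simp_all add: upper_elem_def lower_elem_def four_block_mult[of _ n])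

lemma elem_zero: "upper_elem n (0\<^sub>m n n) = 1\<^sub>m (2 * n)" "lower_elem n (0\<^sub>m n n) = 1\<^sub>m (2 * n)"
  by (simp_all add: upper_elem_def lower_elem_def mult_2)

lemma elem_mult_self:
  assumes "r \<in> carrier_mat n n" "(1::'a::comm_ring_1) + 1 = 0"
  shows "upper_elem n r * upper_elem n r = (1\<^sub>m (2 * n) :: 'a mat)"
    and "lower_elem n r * lower_elem n r = (1\<^sub>m (2 * n) :: 'a mat)"
  using assms by (simp_all add: elem_mult mat_double_char_2 elem_zero)

lemma block_diag_mult:
  assumes "u \<in> carrier_mat n n" "v \<in> carrier_mat n n" "u' \<in> carrier_mat n n" "v' \<in> carrier_mat n n"
  shows "block_diag n u v * block_diag n u' v' = block_diag n (u * u') (v * v')"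
  using assms by (simp add: block_diag_def four_block_mult[of _ n])

lemma block_diag_one: "block_diag n (1\<^sub>m n) (1\<^sub>m n) = 1\<^sub>m (2 * n)"
  by (simp add: block_diag_def mult_2)

text \<open>The usual factorization \<open>diag(u, 1/u) = w(u) w(1)\<close>, up to signs, which vanish in characteristic 2.\<close>

lemma block_diag_eq_elem_product:
  assumes u: "u \<in> carrier_mat n n" and v: "v \<in> carrier_mat n n"
    and uv: "u * v = 1\<^sub>m n" "v * u = 1\<^sub>m n" and char2: "(1::'a::comm_ring_1) + 1 = 0"
  shows "upper_elem n u * lower_elem n v * upper_elem n u
      * (upper_elem n (1\<^sub>m n) * lower_elem n (1\<^sub>m n) * upper_elem n (1\<^sub>m n))
    = (block_diag n u v :: 'a mat)"
proof -
  \<comment> \<open>This is \<open>w(x)\<close> with \<open>y\<close> the inverse of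
    \<open>x\<close>: the diagonal blocks \<open>1 + x * y\<close> and \<open>1 + y * x\<close>
    vanish in characteristic 2.\<close>
  have w: "upper_elem n x * lower_elem n y * upper_elem n x
      = four_block_mat (0\<^sub>m n n) x y (0\<^sub>m n n :: 'a mat)"
    if "x \<in> carrier_mat n n" "y \<in> carrier_mat n n" "x * y = 1\<^sub>m n" "y * x = 1\<^sub>m n" for x y
    using that mat_double_char_2[OF one_carrier_mat char2, of n] mat_double_char_2[OF that(1) char2]
    by (simp add: upper_elem_def lower_elem_def four_block_mult[of _ n])
  show ?thesis
    using u v by (simp add: w[OF u v uv] w block_diag_def four_block_mult[of _ n])
qed

text \<open>\<open>d'\<close> is the inverse of \<open>d\<close>. On the upper right block each side
  contributes a factor \<open>a\<close>; for the lower left block \<open>d\<close> and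
  \<open>d'\<close> exchange roles.\<close>

lemma block_diag_conj_elem:
  fixes a :: "'a::field"
  assumes r: "r \<in> carrier_mat n n" and a: "a \<noteq> 0"
  defines "d \<equiv> block_diag n (a \<cdot>\<^sub>m 1\<^sub>m n) (inverse a \<cdot>\<^sub>m 1\<^sub>m n)"
    and "d' \<equiv> block_diag n (inverse a \<cdot>\<^sub>m 1\<^sub>m n) (a \<cdot>\<^sub>m 1\<^sub>m n)"
  shows "d * upper_elem n r * d' = upper_elem n ((a * a) \<cdot>\<^sub>m r)"
    and "d' * lower_elem n r * d = lower_elem n ((a * a) \<cdot>\<^sub>m r)"
proof -
  have s: "(x \<cdot>\<^sub>m 1\<^sub>m n) * M = x \<cdot>\<^sub>m M" "M * (x \<cdot>\<^sub>m 1\<^sub>m n) = x \<cdot>\<^sub>m M"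
    "x \<cdot>\<^sub>m (y \<cdot>\<^sub>m M) = (x * y) \<cdot>\<^sub>m M"
    if "M \<in> carrier_mat n n" for x y :: 'a and M
    using that by (auto simp: mult_smult_assoc_mat[of _ n n] mult_smult_distrib[of _ n n] intro!: eq_matI)
  have o: "1 \<cdot>\<^sub>m 1\<^sub>m n = (1\<^sub>m n :: 'a mat)" by (intro eq_matI) auto
  show "d * upper_elem n r * d' = upper_elem n ((a * a) \<cdot>\<^sub>m r)"
    "d' * lower_elem n r * d = lower_elem n ((a * a) \<cdot>\<^sub>m r)"
    using r a by (simp_all add: d_def d'_def upper_elem_def lower_elem_def block_diag_def
      four_block_mult[of _ n] s o)
qed

section \<open>The elementary group inside \<open>SL_2n\<close> and its perfectness\<close>

abbreviation SL2n :: "nat \<Rightarrow> 'a::comm_ring_1 mat monoid" where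
  "SL2n n \<equiv> special_linear_group TYPE('a) (2 * n)"

lemma SL_simps:
  "carrier (special_linear_group TYPE('a::comm_ring_1) m) = {A \<in> carrier_mat m m. det A = 1}"
  "x \<otimes>\<^bsub>special_linear_group TYPE('a) m\<^esub> y = x * y"
  "\<one>\<^bsub>special_linear_group TYPE('a) m\<^esub> = 1\<^sub>m m"
  by (simp_all add: special_linear_group_def)

definition elem_gens :: "nat \<Rightarrow> 'a::comm_ring_1 mat set" where
  "elem_gens n = upper_elem n ` const_diag_upper n \<union> lower_elem n ` const_diag_upper n"

definition elem_group :: "nat \<Rightarrow> 'a::comm_ring_1 mat set" where
  "elem_group n = generate (SL2n n) (elem_gens n)"

lemma elem_gens_subset: "elem_gens n \<subseteq> carrier (SL2n n :: 'a::idom mat monoid)"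
proof -
  have "upper_elem n r \<in> carrier (SL2n n) \<and> lower_elem n r \<in> carrier (SL2n n)"
    if "r \<in> carrier_mat n n" for r :: "'a mat"
    using that det_four_block_mat_lower_left_zero[of "1\<^sub>m n" n r n "0\<^sub>m n n" "1\<^sub>m n"]
      det_four_block_mat_upper_right_zero[of "1\<^sub>m n" n "0\<^sub>m n n" n r "1\<^sub>m n"]
    by (simp add: SL_simps upper_elem_def lower_elem_def mult_2)
  then show ?thesis by (auto simp: elem_gens_def dest: const_diag_upper_carrier)
qed

lemma subgroup_elem_group: "subgroup (elem_group n) (SL2n n :: 'a::idom mat monoid)"
  unfolding elem_group_def
  by (rule group.generate_is_subgroup[OF group_special_linear_group elem_gens_subset])

text \<open>The ring of 2 by 2 matrices over \<open>T\<close>, in block form. It contains the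
  elementary group and is closed under products, and the top coefficients of its constant families
  are easy to read off.\<close>

definition const_diag_blocks :: "nat \<Rightarrow> 'a::comm_ring_1 mat set" where
  "const_diag_blocks n = {four_block_mat p q r s | p q r s.
     p \<in> const_diag_upper n \<and> q \<in> const_diag_upper n \<and> r \<in> const_diag_upper n \<and> s \<in> const_diag_upper n}"

lemma const_diag_blocks_mult:
  assumes "M \<in> const_diag_blocks n" "M' \<in> const_diag_blocks n"
  shows "M * M' \<in> const_diag_blocks n"
proof -
  obtain p q r s p' q' r' s' where M: "M = four_block_mat p q r s" "M' = four_block_mat p' q' r' s'"
    and c: "p \<in> const_diag_upper n" "q \<in> const_diag_upper n" "r \<in> const_diag_upper n" "s \<in> const_diag_upper n"
      "p' \<in> const_diag_upper n" "q' \<in> const_diag_upper n" "r' \<in> const_diag_upper n" "s' \<in> const_diag_upper n"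
    using assms unfolding const_diag_blocks_def by blast
  have "M * M' = four_block_mat (p * p' + q * r') (p * q' + q * s') (r * p' + s * r') (r * q' + s * s')"
    unfolding M by (rule four_block_mult[of _ n]) (intro const_diag_upper_carrier c)+
  then show ?thesis
    unfolding const_diag_blocks_def using c const_diag_upper_add const_diag_upper_mult by blast
qed

lemma inv_SL_eqI:
  assumes "A \<in> carrier (special_linear_group TYPE('a::comm_ring_1) m)"
    "B \<in> carrier (special_linear_group TYPE('a) m)" "B * A = 1\<^sub>m m"
  shows "inv\<^bsub>special_linear_group TYPE('a) m\<^esub> A = B"
  using assms by (intro group.inv_equality[OF group_special_linear_group]) (simp_all add: SL_simps)

lemma elem_gens_inv:
  assumes "(1::'a::field) + 1 = 0" "E \<in> elem_gens n"
  shows "inv\<^bsub>SL2n n\<^esub> E = (E :: 'a mat)"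
proof (rule inv_SL_eqI)
  show "E * E = 1\<^sub>m (2 * n)"
    using assms by (auto simp: elem_gens_def elem_mult_self dest: const_diag_upper_carrier)
qed (use elem_gens_subset assms(2) in blast)+

text \<open>By induction over the generation process; the generators are involutions, so inverses of
  generators bring nothing new.\<close>

lemma elem_group_const_diag_blocks:
  assumes "(1::'a::field) + 1 = 0"
  shows "elem_group n \<subseteq> (const_diag_blocks n :: 'a mat set)"
proof
  fix M :: "'a mat" assume "M \<in> elem_group n"
  have gens: "E \<in> const_diag_blocks n" if "E \<in> elem_gens n" for E :: "'a mat"
    using that const_diag_upper_one const_diag_upper_zero
    unfolding elem_gens_def upper_elem_def lower_elem_def const_diag_blocks_def by blast
  show "M \<in> const_diag_blocks n"
    using \<open>M \<in> elem_group n\<close> unfolding elem_group_def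
  proof (induction rule: generate.induct)
    case one
    have "1\<^sub>m (2 * n) = four_block_mat (1\<^sub>m n) (0\<^sub>m n n) (0\<^sub>m n n) (1\<^sub>m n :: 'a mat)"
      by (simp add: mult_2)
    then show ?case
      unfolding SL_simps const_diag_blocks_def
      using const_diag_upper_one const_diag_upper_zero by blast
  next
    case (incl E)
    then show ?case by (rule gens)
  next
    case (inv E)
    then show ?case using gens elem_gens_inv[OF assms] by simp
  next
    case (eng M M')
    then show ?case using const_diag_blocks_mult by (simp add: SL_simps)
  qed
qed

lemma block_diag_elem_group:
  assumes "u \<in> const_diag_upper n" "v \<in> const_diag_upper n"
    and "u * v = 1\<^sub>m n" "v * u = 1\<^sub>m n" and char2: "(1::'a::field) + 1 = 0"
  shows "(block_diag n u v :: 'a mat) \<in> elem_group n"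
proof -
  have "E \<in> elem_group n" if "E \<in> elem_gens n" for E :: "'a mat"
    unfolding elem_group_def using that by (rule generate.incl)
  then have e: "upper_elem n r \<in> elem_group n" "lower_elem n r \<in> elem_group n"
    if "r \<in> const_diag_upper n" for r :: "'a mat"
    using that by (auto simp: elem_gens_def)
  have m: "A * B \<in> elem_group n" if "A \<in> elem_group n" "B \<in> elem_group n" for A B :: "'a mat"
    using subgroup.m_closed[OF subgroup_elem_group that] by (simp add: SL_simps)
  show ?thesis
    unfolding block_diag_eq_elem_product[OF assms(1,2)[THEN const_diag_upper_carrier] assms(3-5), symmetric]
    by (intro m e assms const_diag_upper_one)
qed

lemma perfect_elem_group:
  fixes a :: "'a::field"
  assumes char2: "(1::'a) + 1 = 0" and a: "a \<noteq> 0" "a \<noteq> 1"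
  shows "perfect_group ((SL2n n :: 'a mat monoid)\<lparr>carrier := elem_group n\<rparr>)" (is "perfect_group ?G")
proof -
  interpret SL: group "SL2n n :: 'a mat monoid" by (rule group_special_linear_group)
  interpret U: subgroup "elem_group n" "SL2n n :: 'a mat monoid" by (rule subgroup_elem_group)
  interpret G: group ?G by (rule U.subgroup_is_group[OF SL.group_axioms])
  let ?d = "block_diag n (a \<cdot>\<^sub>m 1\<^sub>m n) (inverse a \<cdot>\<^sub>m 1\<^sub>m n)"
  let ?d' = "block_diag n (inverse a \<cdot>\<^sub>m 1\<^sub>m n) (a \<cdot>\<^sub>m 1\<^sub>m n)"
  have o: "1 \<cdot>\<^sub>m 1\<^sub>m n = (1\<^sub>m n :: 'a mat)" by (intro eq_matI) auto
  have one: "(a \<cdot>\<^sub>m 1\<^sub>m n) * (inverse a \<cdot>\<^sub>m 1\<^sub>m n) = (1\<^sub>m n :: 'a mat)"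
    "(inverse a \<cdot>\<^sub>m 1\<^sub>m n) * (a \<cdot>\<^sub>m 1\<^sub>m n) = (1\<^sub>m n :: 'a mat)"
    using a by (simp_all add: mult_smult_smult[of _ n] o)
  have d: "?d \<in> elem_group n" "?d' \<in> elem_group n"
    using one char2 by (auto intro!: block_diag_elem_group const_diag_upper_smult_one)
  have "?d' * ?d = 1\<^sub>m (2 * n)" "?d * ?d' = 1\<^sub>m (2 * n)"
    using one by (simp_all add: block_diag_mult block_diag_one)
  then have dinv: "inv\<^bsub>SL2n n\<^esub> ?d = ?d'" "inv\<^bsub>SL2n n\<^esub> ?d' = ?d"
    using d U.subset by (auto intro!: inv_SL_eqI)
  \<comment> \<open>The middle terms cancel in characteristic 2, so \<open>a \<noteq> 1\<close>
    makes \<open>a * a + 1\<close> invertible.\<close>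
  have "a * a + 1 = (a + 1) * (a + 1)"
    using char2 by (simp add: algebra_simps flip: mult_2)
  moreover have "a + 1 \<noteq> 0"
    using a(2) char_2_double(2)[OF char2, of 1] by (metis eq_neg_iff_add_eq_0)
  ultimately have b: "a * a + 1 \<noteq> 0" by simp
  have gens: "elem_gens n \<subseteq> derived_set ?G (carrier ?G)"
  proof
    fix E :: "'a mat" assume "E \<in> elem_gens n"
    then obtain r where r: "r \<in> const_diag_upper n" and E: "E = upper_elem n r \<or> E = lower_elem n r"
      by (auto simp: elem_gens_def)
    \<comment> \<open>Chosen so that the commutator of the diagonal matrix with the involution of
      entry \<open>s\<close>, which has entry \<open>(a * a + 1) s\<close>, is the generator of
      entry \<open>r\<close>.\<close>
    define s where "s = (inverse (a * a + 1) \<cdot>\<^sub>m 1\<^sub>m n) * r"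
    have s: "s \<in> const_diag_upper n"
      unfolding s_def by (intro const_diag_upper_mult const_diag_upper_smult_one r)
    note c = const_diag_upper_carrier[OF r] const_diag_upper_carrier[OF s]
    have "(a * a) \<cdot>\<^sub>m s + s = r"
    proof (rule eq_matI)
      fix i j assume "i < dim_row r" "j < dim_col r"
      then have ij: "i < n" "j < n" using c by auto
      have "s = inverse (a * a + 1) \<cdot>\<^sub>m r"
        unfolding s_def using c by (simp add: mult_smult_assoc_mat[of _ n n])
      then have "((a * a) \<cdot>\<^sub>m s + s) $$ (i, j) = (a * a + 1) * (inverse (a * a + 1) * r $$ (i, j))"
        using c ij by (simp add: distrib_right)
      then show "((a * a) \<cdot>\<^sub>m s + s) $$ (i, j) = r $$ (i, j)"
        using b by (simp flip: mult.assoc)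
    qed (use c in auto)
    then have eq: "?d * upper_elem n s * ?d' * upper_elem n s = upper_elem n r"
      "?d' * lower_elem n s * ?d * lower_elem n s = lower_elem n r"
      using c a by (simp_all add: block_diag_conj_elem elem_mult)
    have s_gens: "upper_elem n s \<in> elem_gens n" "lower_elem n s \<in> elem_gens n"
      using s by (auto simp: elem_gens_def)
    then have sU: "upper_elem n s \<in> elem_group n" "lower_elem n s \<in> elem_group n"
      by (auto simp: elem_group_def intro: generate.incl)
    have inv: "inv\<^bsub>?G\<^esub> x = inv\<^bsub>SL2n n\<^esub> x" if "x \<in> elem_group n" for x
      using SL.m_inv_consistent[OF subgroup_elem_group that] .
    have comm: "x * y * inv\<^bsub>SL2n n\<^esub> x * inv\<^bsub>SL2n n\<^esub> y \<in> derived_set ?G (carrier ?G)"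
      if "x \<in> elem_group n" "y \<in> elem_group n" for x y
      using that inv by (auto simp: SL_simps)
    from E show "E \<in> derived_set ?G (carrier ?G)"
    proof
      assume "E = upper_elem n r"
      then show ?thesis
        using comm[OF d(1) sU(1)] unfolding dinv elem_gens_inv[OF char2 s_gens(1)] eq by simp
    next
      assume "E = lower_elem n r"
      then show ?thesis
        using comm[OF d(2) sU(2)] unfolding dinv elem_gens_inv[OF char2 s_gens(2)] eq by simp
    qed
  qed
  have "elem_group n = generate ?G (elem_gens n)"
    unfolding elem_group_def
    by (rule SL.generate_consistent[symmetric]) (auto intro: generate.incl subgroup_elem_group[unfolded elem_group_def])
  also have "\<dots> \<subseteq> derived ?G (carrier ?G)"
    unfolding derived_def by (rule G.mono_generate[OF gens])
  finally have "derived ?G (carrier ?G) = carrier ?G"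
    using G.derived_in_carrier[of "carrier ?G"] by auto
  then show ?thesis
    unfolding perfect_group_def using G.group_axioms by blast
qed

section \<open>The subdirect subgroup\<close>

abbreviation elem_power :: "nat \<Rightarrow> (nat \<Rightarrow> 'a::field mat) monoid" where
  "elem_power n \<equiv>
     direct_power ((SL2n n :: 'a mat monoid)\<lparr>carrier := elem_group n\<rparr>) (2 ^ (n - 1))"

lemma group_elem: "group ((SL2n n :: 'a::field mat monoid)\<lparr>carrier := elem_group n\<rparr>)"
  by (rule group.subgroup_imp_group[OF group_special_linear_group subgroup_elem_group])

lemma group_elem_power: "group (elem_power n :: (nat \<Rightarrow> 'a::field mat) monoid)"
  by (intro product_group group_elem)

lemma elem_power_mult:
  "x < 2 ^ (n - 1) \<Longrightarrow> (f \<otimes>\<^bsub>elem_power n\<^esub> g) x = f x * g x"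
  by (simp add: SL_simps)

text \<open>For \<open>k = 0\<close> this is the group \<open>H\<close> of the overview; growing
  \<open>k\<close> gives a descending filtration that bounds its lower central series.\<close>

definition unip_top_set :: "nat \<Rightarrow> nat \<Rightarrow> (nat \<Rightarrow> 'a::field mat) set" where
  "unip_top_set n k = {h \<in> carrier (elem_power n). unip_top n k h (inv\<^bsub>elem_power n\<^esub> h)}"

lemma unip_top_set_antimono: "k \<le> k' \<Longrightarrow> unip_top_set n k' \<subseteq> unip_top_set n k"
  unfolding unip_top_set_def using unip_top_antimono by blast

lemma unip_top_set_mult:
  assumes h: "h \<in> unip_top_set n k" and g: "g \<in> unip_top_set n k"
  shows "h \<otimes>\<^bsub>elem_power n\<^esub> g \<in> unip_top_set n k"
proof -
  interpret P: group "elem_power n :: (nat \<Rightarrow> 'a mat) monoid" by (rule group_elem_power)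
  let ?m = "(\<otimes>\<^bsub>elem_power n\<^esub>) :: (nat \<Rightarrow> 'a mat) \<Rightarrow> _" and ?i = "m_inv (elem_power n) :: (nat \<Rightarrow> 'a mat) \<Rightarrow> _"
  have c: "h \<in> carrier (elem_power n)" "g \<in> carrier (elem_power n)"
    using h g unfolding unip_top_set_def by auto
  have "unip_top n k (\<lambda>x. h x * g x) (\<lambda>x. ?i g x * ?i h x)"
    using h g unfolding unip_top_set_def by (blast intro: unip_top_mult)
  then have "unip_top n k (?m h g) (?m (?i g) (?i h))"
    by (rule unip_top_cong[THEN iffD1, rotated 2]) (simp_all only: elem_power_mult)
  then show ?thesis
    unfolding unip_top_set_def using c P.inv_mult_group[OF c] P.m_closed[OF c] by simp
qed

lemma unip_top_set_commutator:
  assumes h: "h \<in> unip_top_set n k" and g: "g \<in> unip_top_set n 0"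
  shows "h \<otimes>\<^bsub>elem_power n\<^esub> g \<otimes>\<^bsub>elem_power n\<^esub> inv\<^bsub>elem_power n\<^esub> h \<otimes>\<^bsub>elem_power n\<^esub> inv\<^bsub>elem_power n\<^esub> g
    \<in> unip_top_set n (Suc k)"
proof -
  interpret P: group "elem_power n :: (nat \<Rightarrow> 'a mat) monoid" by (rule group_elem_power)
  let ?m = "(\<otimes>\<^bsub>elem_power n\<^esub>) :: (nat \<Rightarrow> 'a mat) \<Rightarrow> _" and ?i = "m_inv (elem_power n) :: (nat \<Rightarrow> 'a mat) \<Rightarrow> _"
  have c: "h \<in> carrier (elem_power n)" "g \<in> carrier (elem_power n)"
    using h g unfolding unip_top_set_def by auto
  have "unip_top n (Suc k) (\<lambda>x. h x * g x * ?i h x * ?i g x) (\<lambda>x. g x * h x * ?i g x * ?i h x)"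
    using h g unfolding unip_top_set_def by (blast intro: unip_top_commutator)
  then have "unip_top n (Suc k) (?m (?m (?m h g) (?i h)) (?i g)) (?m (?m (?m g h) (?i g)) (?i h))"
    by (rule unip_top_cong[THEN iffD1, rotated 2]) (simp_all only: elem_power_mult)
  \<comment> \<open>The inverse of the commutator of \<open>h\<close> and \<open>g\<close> is the
    commutator of \<open>g\<close> and \<open>h\<close>, the second family supplied by
    \<open>unip_top_commutator\<close>.\<close>
  moreover have "?i (?m (?m (?m h g) (?i h)) (?i g)) = ?m (?m (?m g h) (?i g)) (?i h)"
    using c by (simp only: P.inv_mult_group P.inv_inv P.m_assoc P.m_closed P.inv_closed)
  moreover have "?m (?m (?m h g) (?i h)) (?i g) \<in> carrier (elem_power n)"
    using c by (intro P.m_closed P.inv_closed)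
  ultimately show ?thesis
    unfolding unip_top_set_def by simp
qed

lemma twisted_one_block:
  assumes "C \<in> carrier_mat n n"
  shows "twisted n C (block_diag n C C)"
proof -
  have "block_diag n C C = four_block_mat (1 \<cdot>\<^sub>m C) (0 \<cdot>\<^sub>m C) (0 \<cdot>\<^sub>m C) (1 \<cdot>\<^sub>m C)"
    unfolding block_diag_def using assms by (intro cong_four_block_mat eq_matI) auto
  then show ?thesis unfolding twisted_def by blast
qed

text \<open>All four blocks have scalar top coefficients, so the Kronecker factor \<open>C\<close>
  can be taken to be 1, which has every depth \<open>k\<close>.\<close>

lemma unip_top_const:
  assumes M: "M \<in> const_diag_blocks n" "M' \<in> const_diag_blocks n" and char2: "(1::'a::comm_ring_1) + 1 = 0"
  shows "unip_top n k (\<lambda>_. M) (\<lambda>_. M' :: 'a mat)"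
proof -
  have "block_family n (\<lambda>_. A) \<and> twisted n (1\<^sub>m n) (block_top n (\<lambda>_. A))"
    if A: "A \<in> const_diag_blocks n" for A :: "'a mat"
  proof -
    obtain p q r s where A: "A = four_block_mat p q r s"
      and c: "p \<in> const_diag_upper n" "q \<in> const_diag_upper n" "r \<in> const_diag_upper n" "s \<in> const_diag_upper n"
      using A unfolding const_diag_blocks_def by blast
    have "n \<le> Suc (n - 1)" by simp
    note fb = cube_family_four_block[OF c[THEN cube_family_const] this]
    show ?thesis
      unfolding A block_family_def block_top_def twisted_def fb(2)
      using fb(1) c[THEN top_coeff_const, OF char2] by metis
  qed
  then show ?thesis
    using M by (intro unip_topI[of _ _ _ "1\<^sub>m n" _ "1\<^sub>m n"]) (auto simp: unip_one)
qed

text \<open>The family \<open>x \<mapsto> diag(u, u)^{x_j}\<close> with \<open>u = 1 + e_{j,j+1}\<close>.\<close>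

definition face_elem :: "nat \<Rightarrow> nat \<Rightarrow> nat \<Rightarrow> 'a::comm_ring_1 mat" where
  "face_elem n j x = (let u = addrow_mat n (of_bool (odd (x div 2 ^ j))) j (Suc j) in block_diag n u u)"

lemma face_elem_family:
  "block_family n (face_elem n j :: nat \<Rightarrow> 'a::comm_ring_1 mat)"
  "block_top n (face_elem n j) = block_diag n (addrow_mat n 1 j (Suc j)) (addrow_mat n (1::'a::comm_ring_1) j (Suc j))"
proof -
  have "n \<le> Suc (n - 1)" by simp
  note c = cube_family_addrow_mat(1)[where 'a = 'a, of n "n - 1" j]
    cube_family_const[OF const_diag_upper_zero[where 'a = 'a], of n "n - 1"]
  note fb = cube_family_four_block[OF c(1,2,2,1) \<open>n \<le> Suc (n - 1)\<close>]
  have z: "top_coeff n (\<lambda>i. i) (\<lambda>_. 0\<^sub>m n n :: 'a mat) = 0\<^sub>m n n"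
    by (intro eq_matI) (auto simp: top_coeff_def)
  show "block_family n (face_elem n j :: nat \<Rightarrow> 'a mat)"
    using fb(1) unfolding block_family_def face_elem_def[abs_def] block_diag_def Let_def .
  show "block_top n (face_elem n j) = block_diag n (addrow_mat n 1 j (Suc j)) (addrow_mat n (1::'a::comm_ring_1) j (Suc j))"
    using fb(2) unfolding block_top_def face_elem_def[abs_def] block_diag_def Let_def
      cube_family_addrow_mat(2) z .
qed


lemma subgroup_unip_top_set:
  assumes char2: "(1::'a::field) + 1 = 0"
  shows "subgroup (unip_top_set n k) (elem_power n :: (nat \<Rightarrow> 'a mat) monoid)"
proof -
  interpret P: group "elem_power n :: (nat \<Rightarrow> 'a mat) monoid" by (rule group_elem_power)
  have "1\<^sub>m (2 * n) \<in> (elem_group n :: 'a mat set)"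
    using subgroup.one_closed[OF subgroup_elem_group] by (simp add: SL_simps)
  then have one: "1\<^sub>m (2 * n) \<in> (const_diag_blocks n :: 'a mat set)"
    using elem_group_const_diag_blocks[OF char2] by blast
  have "unip_top n k (\<one>\<^bsub>elem_power n\<^esub>) (\<one>\<^bsub>elem_power n\<^esub> :: nat \<Rightarrow> 'a mat)"
    by (rule unip_top_cong[THEN iffD1, OF _ _ unip_top_const[OF one one char2]]) (simp_all add: SL_simps)
  then have "\<one>\<^bsub>elem_power n\<^esub> \<in> (unip_top_set n k :: (nat \<Rightarrow> 'a mat) set)"
    unfolding unip_top_set_def using P.one_closed P.inv_one by simp
  moreover have "inv\<^bsub>elem_power n\<^esub> h \<in> unip_top_set n k" if "h \<in> unip_top_set n k" for h :: "nat \<Rightarrow> 'a mat"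
    using that unip_top_sym P.inv_inv P.inv_closed unfolding unip_top_set_def by fastforce
  moreover have "unip_top_set n k \<subseteq> carrier (elem_power n :: (nat \<Rightarrow> 'a mat) monoid)"
    unfolding unip_top_set_def by blast
  ultimately show ?thesis
    using unip_top_set_mult by (intro P.subgroupI) blast+
qed

text \<open>Constant families make every coordinate projection surjective.\<close>

lemma const_in_unip_top_set:
  assumes M: "M \<in> elem_group n" and char2: "(1::'a::field) + 1 = 0"
  shows "(\<lambda>_\<in>{..<2 ^ (n - 1)}. M :: 'a mat) \<in> unip_top_set n k"
proof -
  let ?G = "(SL2n n :: 'a mat monoid)\<lparr>carrier := elem_group n\<rparr>"
  interpret G: group ?G by (rule group_elem)
  have c: "(\<lambda>_\<in>{..<2 ^ (n - 1)}. M) \<in> carrier (elem_power n)" using M by simp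
  have "inv\<^bsub>?G\<^esub> M \<in> elem_group n" using G.inv_closed[of M] M by simp
  then have "unip_top n k (\<lambda>_. M) (\<lambda>_. inv\<^bsub>?G\<^esub> M)"
    using M elem_group_const_diag_blocks[OF char2] unip_top_const char2 by blast
  moreover have "inv\<^bsub>elem_power n\<^esub> (\<lambda>_\<in>{..<2 ^ (n - 1)}. M) = (\<lambda>_\<in>{..<2 ^ (n - 1)}. inv\<^bsub>?G\<^esub> M)"
    using c group_elem by (subst inv_product_group) (auto intro!: restrict_ext)
  ultimately have "unip_top n k (\<lambda>_\<in>{..<2 ^ (n - 1)}. M) (inv\<^bsub>elem_power n\<^esub> (\<lambda>_\<in>{..<2 ^ (n - 1)}. M))"
    by (elim unip_top_cong[THEN iffD1, rotated 2]) simp_all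
  then show ?thesis unfolding unip_top_set_def using c by blast
qed

text \<open>A transvection \<open>u\<close> is an involution, so \<open>diag(u, u)\<close> has the
  form \<open>diag(u, 1/u)\<close> and lies in the elementary group; for the same reason the family
  is its own inverse.\<close>

lemma face_elem_in_power:
  fixes n j :: nat
  assumes j: "Suc j < n" and char2: "(1::'a::field) + 1 = 0"
  defines "f \<equiv> (\<lambda>x\<in>{..<2 ^ (n - 1)}. face_elem n j x :: 'a mat)"
  shows "f \<in> unip_top_set n 0" and "inv\<^bsub>elem_power n\<^esub> f = f"
    and "block_top n f = block_diag n (addrow_mat n 1 j (Suc j)) (addrow_mat n 1 j (Suc j))"
proof -
  interpret P: group "elem_power n :: (nat \<Rightarrow> 'a mat) monoid" by (rule group_elem_power)
  have sq: "addrow_mat n a j (Suc j) * addrow_mat n a j (Suc j) = 1\<^sub>m n" for a :: 'a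
    using j by (intro addrow_mat_mult_self char2) auto
  have "face_elem n j x \<in> (elem_group n :: 'a mat set)" for x
    unfolding face_elem_def Let_def
    by (intro block_diag_elem_group const_diag_upper_addrow_mat sq char2) auto
  then have c: "f \<in> carrier (elem_power n)" by (simp add: f_def)
  have "f \<otimes>\<^bsub>elem_power n\<^esub> f = \<one>\<^bsub>elem_power n\<^esub>"
    by (auto simp: f_def SL_simps face_elem_def Let_def block_diag_mult sq block_diag_one intro!: restrict_ext)
  then show inv: "inv\<^bsub>elem_power n\<^esub> f = f" using c by (intro P.inv_equality)
  have eq: "f x = face_elem n j x" if "x < 2 ^ (n - 1)" for x using that by (simp add: f_def)
  have fam: "block_family n f"
    using block_family_cong(1)[of n f "face_elem n j"] eq face_elem_family(1) by blast
  show top: "block_top n f = block_diag n (addrow_mat n 1 j (Suc j)) (addrow_mat n 1 j (Suc j))"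
    using block_family_cong(2)[of n f "face_elem n j"] eq face_elem_family(2)[of n j] by simp
  have "unip_top n 0 f f"
  proof (rule unip_topI)
    show "addrow_mat n (1::'a) j (Suc j) \<in> unip n (Suc 0)" by (intro unip_addrow_mat) auto
    then show "addrow_mat n (1::'a) j (Suc j) \<in> unip n (Suc 0)" .
  qed (auto simp: fam top sq intro: twisted_one_block)
  then show "f \<in> unip_top_set n 0" unfolding unip_top_set_def using c inv by simp
qed

section \<open>The lower central series of the subdirect subgroup\<close>

abbreviation unip_top_group :: "nat \<Rightarrow> (nat \<Rightarrow> 'a::field mat) monoid" where
  "unip_top_group n \<equiv> (elem_power n)\<lparr>carrier := unip_top_set n 0\<rparr>"

lemma lower_central_series_unip_top_group:
  assumes char2: "(1::'a::field) + 1 = 0"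
  shows "lower_central_series (unip_top_group n :: (nat \<Rightarrow> 'a mat) monoid) k \<subseteq> unip_top_set n k"
proof (induction k)
  case 0
  show ?case by simp
next
  case (Suc k)
  interpret P: group "elem_power n :: (nat \<Rightarrow> 'a mat) monoid" by (rule group_elem_power)
  note sub = subgroup_unip_top_set[OF char2, of n]
  interpret H: group "unip_top_group n :: (nat \<Rightarrow> 'a mat) monoid" by (rule P.subgroup_imp_group[OF sub])
  have "subgroup (unip_top_set n (Suc k)) (unip_top_group n :: (nat \<Rightarrow> 'a mat) monoid)"
    using P.subgroup_incl[OF sub sub unip_top_set_antimono] by simp
  moreover have "x \<otimes>\<^bsub>unip_top_group n\<^esub> y \<otimes>\<^bsub>unip_top_group n\<^esub> inv\<^bsub>unip_top_group n\<^esub> x \<otimes>\<^bsub>unip_top_group n\<^esub> inv\<^bsub>unip_top_group n\<^esub> y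
      \<in> unip_top_set n (Suc k)"
    if "x \<in> lower_central_series (unip_top_group n) k" "y \<in> carrier (unip_top_group n)" for x y :: "nat \<Rightarrow> 'a mat"
  proof -
    have xy: "x \<in> unip_top_set n k" "x \<in> unip_top_set n 0" "y \<in> unip_top_set n 0"
      using that Suc.IH unip_top_set_antimono[of 0 k n] by auto
    show ?thesis
      using unip_top_set_commutator[OF xy(1,3)]
      unfolding P.m_inv_consistent[OF sub xy(2)] P.m_inv_consistent[OF sub xy(3)] by simp
  qed
  ultimately show ?case
    by (simp only: lower_central_series.simps) (rule H.generate_subgroup_incl, blast)
qed

text \<open>The next witness is the commutator of \<open>w\<close> with the face family in direction
  \<open>Suc c\<close>; the Steinberg relation moves the top entry one column to the right. The
  inverse of \<open>w\<close> enters the commutator, so its top coefficients are carried through the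
  induction as well.\<close>

lemma ex_iterated_commutator:
  assumes char2: "(1::'a::field) + 1 = 0" and c: "Suc c < n"
  shows "\<exists>w\<in>lower_central_series (unip_top_group n :: (nat \<Rightarrow> 'a mat) monoid) c.
    block_top n w = block_diag n (addrow_mat n 1 0 (Suc c)) (addrow_mat n 1 0 (Suc c)) \<and>
    block_top n (inv\<^bsub>elem_power n\<^esub> w) = block_diag n (addrow_mat n 1 0 (Suc c)) (addrow_mat n 1 0 (Suc c))"
  using c
proof (induction c)
  case 0
  note f = face_elem_in_power[OF 0 char2]
  have "(\<lambda>x\<in>{..<2 ^ (n - 1)}. face_elem n 0 x) \<in> lower_central_series (unip_top_group n :: (nat \<Rightarrow> 'a mat) monoid) 0"
    using f(1) by simp
  then show ?case
    by (rule bexI[rotated]) (simp_all only: f simp_thms)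
next
  case (Suc c)
  interpret P: group "elem_power n :: (nat \<Rightarrow> 'a mat) monoid" by (rule group_elem_power)
  note sub = subgroup_unip_top_set[OF char2, of n]
  let ?m = "(\<otimes>\<^bsub>elem_power n\<^esub>) :: (nat \<Rightarrow> 'a mat) \<Rightarrow> _" and ?i = "m_inv (elem_power n) :: (nat \<Rightarrow> 'a mat) \<Rightarrow> _"
  define X where "X = addrow_mat n (1::'a) 0 (Suc c)"
  define Y where "Y = addrow_mat n (1::'a) (Suc c) (Suc (Suc c))"
  have XY: "X \<in> carrier_mat n n" "Y \<in> carrier_mat n n" by (auto simp: X_def Y_def)
  obtain w where w: "w \<in> lower_central_series (unip_top_group n) c"
    "block_top n w = block_diag n X X" "block_top n (?i w) = block_diag n X X"
    using Suc unfolding X_def by auto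
  define f :: "nat \<Rightarrow> 'a mat" where "f = (\<lambda>x\<in>{..<2 ^ (n - 1)}. face_elem n (Suc c) x)"
  have f: "f \<in> unip_top_set n 0" "?i f = f" "block_top n f = block_diag n Y Y"
    using face_elem_in_power[OF Suc.prems char2] by (auto simp: f_def Y_def)
  have w0: "w \<in> unip_top_set n 0"
    using w(1) lower_central_series_unip_top_group[OF char2] unip_top_set_antimono[of 0 c n] by blast
  have car: "w \<in> carrier (elem_power n)" "f \<in> carrier (elem_power n)"
    using w0 f(1) unfolding unip_top_set_def by auto
  have fam: "block_family n w" "block_family n (?i w)" "block_family n f"
    using w0 f(1) unfolding unip_top_set_def unip_top_def by auto
  \<comment> \<open>As \<open>f\<close> is its own inverse, this is the commutator of
    \<open>w\<close> and \<open>f\<close>.\<close>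
  define v where "v = ?m (?m (?m w f) (?i w)) f"
  have v': "?i v = ?m (?m (?m f w) f) (?i w)"
    unfolding v_def using car f(2)
    by (simp only: P.inv_mult_group P.inv_inv P.m_assoc P.m_closed P.inv_closed)
  have "v = w \<otimes>\<^bsub>unip_top_group n\<^esub> f \<otimes>\<^bsub>unip_top_group n\<^esub> inv\<^bsub>unip_top_group n\<^esub> w \<otimes>\<^bsub>unip_top_group n\<^esub> inv\<^bsub>unip_top_group n\<^esub> f"
    unfolding P.m_inv_consistent[OF sub w0] P.m_inv_consistent[OF sub f(1)] f(2) v_def by simp
  then have v: "v \<in> lower_central_series (unip_top_group n) (Suc c)"
    unfolding lower_central_series.simps using w(1) f(1) by (intro generate.incl) auto
  have tw: "block_top n v = block_top n (\<lambda>x. w x * f x * ?i w x * f x)"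
    unfolding v_def by (rule block_family_cong(2)) (simp only: elem_power_mult)
  have tv: "block_top n (?i v) = block_top n (\<lambda>x. f x * w x * f x * ?i w x)"
    unfolding v' by (rule block_family_cong(2)) (simp only: elem_power_mult)
  have "block_top n v = block_diag n (X * Y * X * Y) (X * Y * X * Y)"
    unfolding tw by (simp only: fam XY block_family_mult w(2,3) f(3) block_diag_mult mult_carrier_mat[of _ n n _ n])
  moreover have "block_top n (?i v) = block_diag n (Y * X * Y * X) (Y * X * Y * X)"
    unfolding tv by (simp only: fam XY block_family_mult w(2,3) f(3) block_diag_mult mult_carrier_mat[of _ n n _ n])
  ultimately show ?case
    using v addrow_mat_commutator[OF _ _ _ char2, of 0 "Suc c" "Suc (Suc c)" n] Suc.prems
    unfolding X_def Y_def by auto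
qed

text \<open>In term \<open>n - 1\<close> the factor \<open>C\<close> lies in
  \<open>unip n n\<close>, so it is the identity and entry \<open>(0, Suc c)\<close> of the top
  coefficients is 0, whereas the iterated commutator in term \<open>c\<close> has 1 there.\<close>

lemma lower_central_series_unip_top_group_strict:
  assumes char2: "(1::'a::field) + 1 = 0" and c: "c < n - 1"
  shows "\<not> lower_central_series (unip_top_group n :: (nat \<Rightarrow> 'a mat) monoid) c
    \<subseteq> lower_central_series (unip_top_group n) (n - 1)"
proof
  assume sub: "lower_central_series (unip_top_group n :: (nat \<Rightarrow> 'a mat) monoid) c
    \<subseteq> lower_central_series (unip_top_group n) (n - 1)"
  have cn: "Suc c < n" using c by simp
  let ?X = "addrow_mat n (1::'a) 0 (Suc c)"
  obtain w :: "nat \<Rightarrow> 'a mat" where w: "w \<in> lower_central_series (unip_top_group n) c"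
    and t: "block_top n w = block_diag n ?X ?X"
    using ex_iterated_commutator[OF char2 cn] by blast
  have "w \<in> unip_top_set n (n - 1)"
    using w sub lower_central_series_unip_top_group[OF char2] by blast
  then obtain C where C: "C \<in> unip n (Suc (n - 1))" and "twisted n C (block_top n w)"
    unfolding unip_top_set_def unip_top_def by blast
  then obtain \<alpha> \<beta> \<gamma> \<delta> where
    "block_diag n ?X ?X = four_block_mat (\<alpha> \<cdot>\<^sub>m C) (\<beta> \<cdot>\<^sub>m C) (\<gamma> \<cdot>\<^sub>m C) (\<delta> \<cdot>\<^sub>m C)"
    unfolding twisted_def t by blast
  then have "block_diag n ?X ?X $$ (0, Suc c)
      = four_block_mat (\<alpha> \<cdot>\<^sub>m C) (\<beta> \<cdot>\<^sub>m C) (\<gamma> \<cdot>\<^sub>m C) (\<delta> \<cdot>\<^sub>m C) $$ (0, Suc c)" by simp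
  then have "1 = \<alpha> * C $$ (0, Suc c)"
    using cn unipD(1)[OF C] by (simp add: block_diag_def)
  moreover have "C $$ (0, Suc c) = 0"
    using unipD(2)[OF C, of 0 "Suc c"] cn by simp
  ultimately show False by simp
qed

theorem mainTheorem5:
  fixes n :: nat
  assumes "CARD('a::field) = 4"
    and "n \<ge> 1"
  shows "\<exists>U G. subgroup U (special_linear_group TYPE('a) (2 * n)) \<and>
      G = (special_linear_group TYPE('a) (2 * n)) \<lparr>carrier := U\<rparr> \<and>
      perfect_group G \<and>
      (\<exists>H N. subdirect_subgroup H {..<2 ^ (n - 1)} (\<lambda>_. G) \<and>
        N \<lhd> (direct_power G (2 ^ (n - 1))) \<lparr>carrier := H\<rparr> \<and>
        nilpotent_group ((direct_power G (2 ^ (n - 1))) \<lparr>carrier := H\<rparr> Mod N) \<and>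
        nilpotency_class ((direct_power G (2 ^ (n - 1))) \<lparr>carrier := H\<rparr> Mod N) = n - 1)"
proof -
  note char2 = char_2_if_card_4[OF assms(1)]
  let ?G = "(SL2n n :: 'a mat monoid)\<lparr>carrier := elem_group n\<rparr>"
  \<comment> \<open>Perfectness rests on a scalar other than 0 and 1, which a field of four elements
    provides.\<close>
  have "(UNIV :: 'a set) \<noteq> {0, 1}"
  proof
    assume "UNIV = {0, 1 :: 'a}"
    then have "CARD('a) = card {0, 1 :: 'a}" by (rule arg_cong)
    then show False using assms(1) by simp
  qed
  then obtain a :: 'a where a: "a \<noteq> 0" "a \<noteq> 1" by blast
  interpret H: group "unip_top_group n :: (nat \<Rightarrow> 'a mat) monoid"
    by (rule group.subgroup_imp_group[OF group_elem_power subgroup_unip_top_set[OF char2]])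
  have "subdirect_subgroup (unip_top_set n 0) {..<2 ^ (n - 1)} (\<lambda>_. ?G)"
    unfolding subdirect_subgroup_def
  proof (intro conjI ballI equalityI subsetI)
    show "subgroup (unip_top_set n 0) (elem_power n :: (nat \<Rightarrow> 'a mat) monoid)"
      by (rule subgroup_unip_top_set[OF char2])
  next
    fix i :: nat and M :: "'a mat" assume i: "i \<in> {..<2 ^ (n - 1)}" and "M \<in> (\<lambda>x. x i) ` unip_top_set n 0"
    then show "M \<in> carrier ?G" by (auto simp: unip_top_set_def PiE_iff)
  next
    fix i :: nat and M :: "'a mat" assume i: "i \<in> {..<2 ^ (n - 1)}" and "M \<in> carrier ?G"
    then have "(\<lambda>_\<in>{..<2 ^ (n - 1)}. M) \<in> unip_top_set n 0"
      by (intro const_in_unip_top_set char2) simp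
    then have "(\<lambda>_\<in>{..<2 ^ (n - 1)}. M) i \<in> (\<lambda>x. x i) ` unip_top_set n 0" by (rule imageI)
    then show "M \<in> (\<lambda>x. x i) ` unip_top_set n 0" using i by simp
  qed
  \<comment> \<open>The normal subgroup is term \<open>n - 1\<close> of the lower central series of
    the subdirect subgroup \<open>unip_top_set n 0\<close>.\<close>
  then show ?thesis
    using subgroup_elem_group perfect_elem_group[OF char2 a]
      H.lower_central_series_normal
      H.Mod_lower_central_series[OF lower_central_series_unip_top_group_strict[OF char2]]
    by blast
qed

end
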